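(* On $\mathcal C_>=\mathbb R^5$ with coordinates $(x,y,z,a,b)$, let $\omega^0=\mathrm dz-a\,\mathrm dx-b\,\mathrm dy$, $\omega^1=\mathrm dx$, $\omega^2=\mathrm dy$, $\omega^3=-\tfrac13\mathrm db$, $\omega^4=\mathrm da$, and $$\Upsilon=3(\omega^2)^2(\omega^3)^2-4\omega^1(\omega^3)^3-4(\omega^2)^3\omega^4+6\omega^1\omega^2\omega^3\omega^4-(\omega^1)^2(\omega^4)^2 .$$ The Lie algebra of infinitesimal symmetries of the $G_2$ contact structure on $\mathcal C_>$ with contact form $\omega^0$ and structural tensor $\Upsilon$ is the split real form of the simple exceptional Lie algebra $\mathfrak g_2$. It is spanned by the following 14 vector fields on $\mathcal C_>$: $$\begin{aligned} X_1&=(y^3+xz)\partial_x+(yz-\tfrac19b^2x-\tfrac23by^2)\partial_y+(z^2-\tfrac{2}{27}b^3x-\tfrac13b^2y^2)\partial_z\\ &\quad+(az-a^2x-aby+\tfrac{1}{27}b^3)\partial_a+(bz-abx-3ay^2-\tfrac13b^2y)\partial_b,\\ X_2&=x^2\partial_x+xy\partial_y+(xz-y^3)\partial_z+(z-ax-by)\partial_a-3y^2\partial_b,\\ X_3&=-\tfrac12z\partial_x+\tfrac{1}{18}b^2\partial_y+\tfrac{1}{27}b^3\partial_z+\tfrac12a^2\partial_a+\tfrac12ab\partial_b,\\ X_4&=-3y^2\partial_x+(\tfrac43by-z)\partial_y+\tfrac23b^2y\partial_z+ab\partial_a+(6ay+\tfrac13b^2)\partial_b,\\ X_5&=\tfrac13y\partial_y+z\partial_z+a\partial_a+\tfrac23b\partial_b,\\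 X_6&=\tfrac92xy\partial_x+(\tfrac32y^2-bx)\partial_y+\tfrac12(9yz-b^2x)\partial_z+\tfrac12b^2\partial_a+\tfrac12(9z+3by-9ax)\partial_b,\\ X_7&=-x\partial_y+3y^2\partial_z+b\partial_a+6y\partial_b,\\ X_8&=x\partial_x+\tfrac23y\partial_y+z\partial_z+\tfrac13b\partial_b,\\ X_9&=y\partial_x-\tfrac29b\partial_y-\tfrac19b^2\partial_z-a\partial_b,\\ X_{10}&=x\partial_z+\partial_a,\quad X_{11}=y\partial_z+\partial_b,\quad X_{12}=\partial_x,\quad X_{13}=\partial_y,\quad X_{14}=\partial_z. \end{aligned}$$
   Context: Products of 1-forms in $\Upsilon$ are symmetric tensor products, so $\Upsilon$ is a symmetric rank 4 tensor, regarded as defined on the contact distribution $\mathcal D=\ker\omega^0$. A $G_2$ contact structure on a 5-dimensional contact manifold is a reduction of the structure group of the contact distribution $\mathcal D$ from $\mathrm{GL}(4,\mathbb R)$ to $\mathrm{GL}(2,\mathbb R)$ in its irreducible 4-dimensional representation, contained in the conformal symplectic group $\mathrm{CSp}(\mathrm d\omega^0|_{\mathcal D})$; equivalently it is given by a contact form $\omega^0$ and a symmetric rank 4 tensor $\Upsilon$ on $\mathcal D$, both up to scale, whose common conformal stabilizer is this irreducible $\mathrm{GL}(2,\mathbb R)$. An infinitesimal symmetry is a vector field $X$ on the manifold such that $(\mathcal L_X\omega^0)\wedge\omega^0=0$ and $\mathcal L_X\Upsilon=h\Upsilon+\omega^0\chi$ for some function $h$ and some symmetric rank 3 tensor $\chi$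 (the product $\omega^0\chi$ being the symmetric product). *)

theory Defs
  imports "HOL-Analysis.Analysis" "HOL-Library.Function_Algebras"
begin

section \<open>Functions as a real vector space\<close>

instantiation "fun" :: (type, real_vector) real_vector
begin

definition scaleR_fun :: "real \<Rightarrow> ('a \<Rightarrow> 'b) \<Rightarrow> 'a \<Rightarrow> 'b"
  where "scaleR_fun c f = (\<lambda>x. c *\<^sub>R f x)"

instance
  by standard (auto simp: scaleR_fun_def fun_eq_iff scaleR_add_right scaleR_add_left)

end


section \<open>Lie algebras\<close>

text \<open>A real Lie algebra is given by its underlying subspace \<open>L\<close> of an ambient real vector space
  and a bracket \<open>br\<close>, of which only the values on \<open>L\<close> matter.\<close>

definition lie_algebra :: "'v::real_vector set \<Rightarrow> ('v \<Rightarrow> 'v \<Rightarrow> 'v) \<Rightarrow> bool" where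
  "lie_algebra L br \<longleftrightarrow>
     subspace L \<and>
     (\<forall>x\<in>L. \<forall>y\<in>L. br x y \<in> L) \<and>
     (\<forall>x\<in>L. \<forall>y\<in>L. \<forall>z\<in>L. br (x + y) z = br x z + br y z \<and> br x (y + z) = br x y + br x z) \<and>
     (\<forall>c. \<forall>x\<in>L. \<forall>y\<in>L. br (c *\<^sub>R x) y = c *\<^sub>R br x y \<and> br x (c *\<^sub>R y) = c *\<^sub>R br x y) \<and>
     (\<forall>x\<in>L. br x x = 0) \<and>
     (\<forall>x\<in>L. \<forall>y\<in>L. \<forall>z\<in>L. br x (br y z) + br y (br z x) + br z (br x y) = 0)"

definition lie_ideal :: "'v::real_vector set \<Rightarrow> ('v \<Rightarrow> 'v \<Rightarrow> 'v) \<Rightarrow> 'v set \<Rightarrow> bool" where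
  "lie_ideal L br I \<longleftrightarrow> subspace I \<and> I \<subseteq> L \<and> (\<forall>x\<in>L. \<forall>y\<in>I. br x y \<in> I)"

definition simple_lie_algebra :: "'v::real_vector set \<Rightarrow> ('v \<Rightarrow> 'v \<Rightarrow> 'v) \<Rightarrow> bool" where
  "simple_lie_algebra L br \<longleftrightarrow>
     lie_algebra L br \<and> (\<exists>x\<in>L. \<exists>y\<in>L. br x y \<noteq> 0) \<and>
     (\<forall>I. lie_ideal L br I \<longrightarrow> I = {0} \<or> I = L)"

definition lie_product :: "('v::real_vector \<Rightarrow> 'v \<Rightarrow> 'v) \<Rightarrow> 'v set \<Rightarrow> 'v set \<Rightarrow> 'v set" where
  "lie_product br A B = span {br x y | x y. x \<in> A \<and> y \<in> B}"

primrec lower_central :: "('v::real_vector \<Rightarrow> 'v \<Rightarrow> 'v) \<Rightarrow> 'v set \<Rightarrow> nat \<Rightarrow> 'v set" where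
  "lower_central br H 0 = H"
| "lower_central br H (Suc n) = lie_product br H (lower_central br H n)"

definition lie_normalizer :: "'v::real_vector set \<Rightarrow> ('v \<Rightarrow> 'v \<Rightarrow> 'v) \<Rightarrow> 'v set \<Rightarrow> 'v set" where
  "lie_normalizer L br H = {x\<in>L. \<forall>y\<in>H. br x y \<in> H}"

definition cartan_subalgebra :: "'v::real_vector set \<Rightarrow> ('v \<Rightarrow> 'v \<Rightarrow> 'v) \<Rightarrow> 'v set \<Rightarrow> bool" where
  "cartan_subalgebra L br H \<longleftrightarrow>
     lie_algebra H br \<and> H \<subseteq> L \<and> (\<exists>n. lower_central br H n = {0}) \<and> lie_normalizer L br H = H"

text \<open>Linear functionals on \<open>H\<close> are represented by functions vanishing off \<open>H\<close>, so that equality,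
  \<open>0\<close>, negation and linear independence of functionals are those of functions.\<close>

definition dual_space :: "'v::real_vector set \<Rightarrow> ('v \<Rightarrow> real) set" where
  "dual_space H = {\<alpha>. (\<forall>x\<in>H. \<forall>y\<in>H. \<alpha> (x + y) = \<alpha> x + \<alpha> y) \<and>
                      (\<forall>c. \<forall>x\<in>H. \<alpha> (c *\<^sub>R x) = c * \<alpha> x) \<and> (\<forall>x. x \<notin> H \<longrightarrow> \<alpha> x = 0)}"

definition weight_space ::
    "'v::real_vector set \<Rightarrow> ('v \<Rightarrow> 'v \<Rightarrow> 'v) \<Rightarrow> 'v set \<Rightarrow> ('v \<Rightarrow> real) \<Rightarrow> 'v set" where
  "weight_space L br H \<alpha> = {x\<in>L. \<forall>h\<in>H. br h x = \<alpha> h *\<^sub>R x}"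

definition lie_roots :: "'v::real_vector set \<Rightarrow> ('v \<Rightarrow> 'v \<Rightarrow> 'v) \<Rightarrow> 'v set \<Rightarrow> ('v \<Rightarrow> real) set" where
  "lie_roots L br H = {\<alpha>\<in>dual_space H. \<alpha> \<noteq> 0 \<and> weight_space L br H \<alpha> \<noteq> {0}}"

text \<open>A Cartan subalgebra is splitting if its adjoint action is simultaneously diagonalizable
  over the reals.\<close>

definition splitting_cartan_subalgebra ::
    "'v::real_vector set \<Rightarrow> ('v \<Rightarrow> 'v \<Rightarrow> 'v) \<Rightarrow> 'v set \<Rightarrow> bool" where
  "splitting_cartan_subalgebra L br H \<longleftrightarrow>
     cartan_subalgebra L br H \<and> span (\<Union>\<alpha>\<in>dual_space H. weight_space L br H \<alpha>) = L"

definition root_base ::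
    "'v::real_vector set \<Rightarrow> ('v \<Rightarrow> 'v \<Rightarrow> 'v) \<Rightarrow> 'v set \<Rightarrow> ('v \<Rightarrow> real) set \<Rightarrow> bool" where
  "root_base L br H B \<longleftrightarrow>
     finite B \<and> B \<subseteq> lie_roots L br H \<and> independent B \<and>
     (\<forall>\<beta>\<in>lie_roots L br H. \<exists>c :: ('v \<Rightarrow> real) \<Rightarrow> nat.
        \<beta> = (\<Sum>\<alpha>\<in>B. real (c \<alpha>) *\<^sub>R \<alpha>) \<or> \<beta> = - (\<Sum>\<alpha>\<in>B. real (c \<alpha>) *\<^sub>R \<alpha>))"

definition is_coroot ::
    "'v::real_vector set \<Rightarrow> ('v \<Rightarrow> 'v \<Rightarrow> 'v) \<Rightarrow> 'v set \<Rightarrow> ('v \<Rightarrow> real) \<Rightarrow> 'v \<Rightarrow> bool" where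
  "is_coroot L br H \<alpha> t \<longleftrightarrow>
     t \<in> lie_product br (weight_space L br H \<alpha>) (weight_space L br H (- \<alpha>)) \<and> \<alpha> t = 2"

text \<open>The root system with respect to \<open>H\<close> has type \<open>G\<^sub>2\<close>: it has a base \<open>{\<alpha>, \<beta>}\<close>, with \<open>\<alpha>\<close> long and
  \<open>\<beta>\<close> short, whose Cartan matrix has off-diagonal entries \<open>\<beta>(\<alpha>\<^sup>\<or>) = -1\<close> and \<open>\<alpha>(\<beta>\<^sup>\<or>) = -3\<close>.\<close>

definition root_system_type_G2 :: "'v::real_vector set \<Rightarrow> ('v \<Rightarrow> 'v \<Rightarrow> 'v) \<Rightarrow> 'v set \<Rightarrow> bool" where
  "root_system_type_G2 L br H \<longleftrightarrow>
     (\<exists>\<alpha> \<beta> s t. \<alpha> \<noteq> \<beta> \<and> root_base L br H {\<alpha>, \<beta>} \<and>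
        is_coroot L br H \<alpha> s \<and> is_coroot L br H \<beta> t \<and> \<beta> s = - 1 \<and> \<alpha> t = - 3)"

text \<open>The split real form of \<open>\<gg>\<^sub>2\<close> (unique up to isomorphism): the finite-dimensional simple real
  Lie algebra that has a splitting Cartan subalgebra with root system of type \<open>G\<^sub>2\<close>.\<close>

definition split_real_form_g2 :: "'v::real_vector set \<Rightarrow> ('v \<Rightarrow> 'v \<Rightarrow> 'v) \<Rightarrow> bool" where
  "split_real_form_g2 L br \<longleftrightarrow>
     (\<exists>B. finite B \<and> L = span B) \<and> simple_lie_algebra L br \<and>
     (\<exists>H. splitting_cartan_subalgebra L br H \<and> root_system_type_G2 L br H)"


section \<open>Vector fields and covariant tensor fields\<close>

primrec times_cont_differentiable ::
    "nat \<Rightarrow> ('a::euclidean_space \<Rightarrow> 'b::real_normed_vector) \<Rightarrow> bool" where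
  "times_cont_differentiable 0 f \<longleftrightarrow> continuous_on UNIV f"
| "times_cont_differentiable (Suc k) f \<longleftrightarrow>
     f differentiable_on UNIV \<and>
     (\<forall>v. times_cont_differentiable k (\<lambda>p. frechet_derivative f (at p) v))"

definition smooth :: "('a::euclidean_space \<Rightarrow> 'b::real_normed_vector) \<Rightarrow> bool" where
  "smooth f \<longleftrightarrow> (\<forall>k. times_cont_differentiable k f)"

definition vf_bracket :: "('a::euclidean_space \<Rightarrow> 'a) \<Rightarrow> ('a \<Rightarrow> 'a) \<Rightarrow> 'a \<Rightarrow> 'a" where
  "vf_bracket X Y = (\<lambda>p. frechet_derivative Y (at p) (X p) - frechet_derivative X (at p) (Y p))"

text \<open>A covariant tensor field of rank \<open>k\<close> maps a point and a list of \<open>k\<close> tangent vectors to a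
  real; its values on lists of any other length are irrelevant.\<close>

type_synonym 'a tensor_field = "'a \<Rightarrow> 'a list \<Rightarrow> real"

definition symmetric_tensor_field :: "nat \<Rightarrow> 'a::euclidean_space tensor_field \<Rightarrow> bool" where
  "symmetric_tensor_field k T \<longleftrightarrow>
     (\<forall>vs. length vs = k \<longrightarrow> smooth (\<lambda>p. T p vs)) \<and>
     (\<forall>p vs i. length vs = k \<and> i < k \<longrightarrow> linear (\<lambda>v. T p (vs[i := v]))) \<and>
     (\<forall>p vs ws. length vs = k \<and> mset ws = mset vs \<longrightarrow> T p ws = T p vs)"

text \<open>The symmetric product \<open>\<alpha> \<odot> T\<close> of a 1-form \<open>\<alpha>\<close> and a symmetric tensor field \<open>T\<close> is the
  symmetrization of \<open>\<alpha> \<otimes> T\<close>; as \<open>T\<close> is symmetric, the average over all permutations reduces to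
  the average over the argument that is inserted into \<open>\<alpha>\<close>.\<close>

definition sym_prod :: "'a tensor_field \<Rightarrow> 'a tensor_field \<Rightarrow> 'a tensor_field" (infixr "\<odot>" 75) where
  "(\<alpha> \<odot> T) = (\<lambda>p vs. (\<Sum>i<length vs. \<alpha> p [vs ! i] * T p (take i vs @ drop (Suc i) vs)) / real (length vs))"

definition wedge_1_forms :: "'a tensor_field \<Rightarrow> 'a tensor_field \<Rightarrow> 'a tensor_field" where
  "wedge_1_forms \<alpha> \<beta> = (\<lambda>p vs. \<alpha> p [vs ! 0] * \<beta> p [vs ! 1] - \<alpha> p [vs ! 1] * \<beta> p [vs ! 0])"

text \<open>The Leibniz formula \<open>(\<L>\<^sub>X T)(v\<^sub>1, \<dots>, v\<^sub>k) = X(T(v\<^sub>1, \<dots>, v\<^sub>k)) - \<Sum>\<^sub>i T(\<dots>, [X, v\<^sub>i], \<dots>)\<close>, evaluated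
  on constant vector fields \<open>v\<^sub>i\<close>, for which \<open>[X, v\<^sub>i] = - DX(v\<^sub>i)\<close>.\<close>

definition lie_derivative ::
    "('a::euclidean_space \<Rightarrow> 'a) \<Rightarrow> 'a tensor_field \<Rightarrow> 'a tensor_field" where
  "lie_derivative X T = (\<lambda>p vs.
     frechet_derivative (\<lambda>q. T q vs) (at p) (X p) +
     (\<Sum>i<length vs. T p (vs[i := frechet_derivative X (at p) (vs ! i)])))"

text \<open>The infinitesimal symmetries of the structure given, up to scale, by a contact form \<open>\<omega>\<close> and
  a symmetric rank 4 tensor field \<open>\<Upsilon>\<close> that matters only on \<open>ker \<omega>\<close>.\<close>

definition infinitesimal_symmetries ::
    "'a::euclidean_space tensor_field \<Rightarrow> 'a tensor_field \<Rightarrow> ('a \<Rightarrow> 'a) set" where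
  "infinitesimal_symmetries \<omega> \<Upsilon> = {X. smooth X \<and>
     (\<forall>p vs. length vs = 2 \<longrightarrow> wedge_1_forms (lie_derivative X \<omega>) \<omega> p vs = 0) \<and>
     (\<exists>(h :: 'a \<Rightarrow> real) \<theta>. smooth h \<and> symmetric_tensor_field 3 \<theta> \<and>
        (\<forall>p vs. length vs = 4 \<longrightarrow>
           lie_derivative X \<Upsilon> p vs = h p * \<Upsilon> p vs + (\<omega> \<odot> \<theta>) p vs))}"


section \<open>The contact structure on \<open>\<real>\<^sup>5\<close>\<close>

text \<open>The coordinates \<open>(x, y, z, a, b)\<close> of \<open>p\<close> are \<open>(p $ 1, p $ 2, p $ 3, p $ 4, p $ 5)\<close>.\<close>

definition d_coord :: "5 \<Rightarrow> (real^5) tensor_field" where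
  "d_coord i = (\<lambda>p vs. hd vs $ i)"

definition omega0 :: "(real^5) tensor_field" where
  "omega0 = (\<lambda>p vs. d_coord 3 p vs - p $ 4 * d_coord 1 p vs - p $ 5 * d_coord 2 p vs)"

definition omega1 :: "(real^5) tensor_field" where "omega1 = d_coord 1"
definition omega2 :: "(real^5) tensor_field" where "omega2 = d_coord 2"
definition omega3 :: "(real^5) tensor_field" where "omega3 = (- 1 / 3) *\<^sub>R d_coord 5"
definition omega4 :: "(real^5) tensor_field" where "omega4 = d_coord 4"

definition Upsilon :: "(real^5) tensor_field" where
  "Upsilon = 3 *\<^sub>R (omega2 \<odot> omega2 \<odot> omega3 \<odot> omega3)
           - 4 *\<^sub>R (omega1 \<odot> omega3 \<odot> omega3 \<odot> omega3)
           - 4 *\<^sub>R (omega2 \<odot> omega2 \<odot> omega2 \<odot> omega4)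
           + 6 *\<^sub>R (omega1 \<odot> omega2 \<odot> omega3 \<odot> omega4)
           - (omega1 \<odot> omega1 \<odot> omega4 \<odot> omega4)"

definition coord_field ::
    "(real \<Rightarrow> real \<Rightarrow> real \<Rightarrow> real \<Rightarrow> real \<Rightarrow> real^5) \<Rightarrow> real^5 \<Rightarrow> real^5" where
  "coord_field F = (\<lambda>p. F (p $ 1) (p $ 2) (p $ 3) (p $ 4) (p $ 5))"

definition X1 :: "real^5 \<Rightarrow> real^5" where
  "X1 = coord_field (\<lambda>x y z a b. vector
     [y^3 + x * z,
      y * z - 1/9 * b^2 * x - 2/3 * b * y^2,
      z^2 - 2/27 * b^3 * x - 1/3 * b^2 * y^2,
      a * z - a^2 * x - a * b * y + 1/27 * b^3,
      b * z - a * b * x - 3 * a * y^2 - 1/3 * b^2 * y])"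

definition X2 :: "real^5 \<Rightarrow> real^5" where
  "X2 = coord_field (\<lambda>x y z a b. vector
     [x^2, x * y, x * z - y^3, z - a * x - b * y, - 3 * y^2])"

definition X3 :: "real^5 \<Rightarrow> real^5" where
  "X3 = coord_field (\<lambda>x y z a b. vector
     [- 1/2 * z, 1/18 * b^2, 1/27 * b^3, 1/2 * a^2, 1/2 * a * b])"

definition X4 :: "real^5 \<Rightarrow> real^5" where
  "X4 = coord_field (\<lambda>x y z a b. vector
     [- 3 * y^2, 4/3 * b * y - z, 2/3 * b^2 * y, a * b, 6 * a * y + 1/3 * b^2])"

definition X5 :: "real^5 \<Rightarrow> real^5" where
  "X5 = coord_field (\<lambda>x y z a b. vector [0, 1/3 * y, z, a, 2/3 * b])"

definition X6 :: "real^5 \<Rightarrow> real^5" where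
  "X6 = coord_field (\<lambda>x y z a b. vector
     [9/2 * x * y,
      3/2 * y^2 - b * x,
      1/2 * (9 * y * z - b^2 * x),
      1/2 * b^2,
      1/2 * (9 * z + 3 * b * y - 9 * a * x)])"

definition X7 :: "real^5 \<Rightarrow> real^5" where
  "X7 = coord_field (\<lambda>x y z a b. vector [0, - x, 3 * y^2, b, 6 * y])"

definition X8 :: "real^5 \<Rightarrow> real^5" where
  "X8 = coord_field (\<lambda>x y z a b. vector [x, 2/3 * y, z, 0, 1/3 * b])"

definition X9 :: "real^5 \<Rightarrow> real^5" where
  "X9 = coord_field (\<lambda>x y z a b. vector [y, - 2/9 * b, - 1/9 * b^2, 0, - a])"

definition X10 :: "real^5 \<Rightarrow> real^5" where
  "X10 = coord_field (\<lambda>x y z a b. vector [0, 0, x, 1, 0])"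

definition X11 :: "real^5 \<Rightarrow> real^5" where
  "X11 = coord_field (\<lambda>x y z a b. vector [0, 0, y, 0, 1])"

definition X12 :: "real^5 \<Rightarrow> real^5" where
  "X12 = coord_field (\<lambda>x y z a b. vector [1, 0, 0, 0, 0])"

definition X13 :: "real^5 \<Rightarrow> real^5" where
  "X13 = coord_field (\<lambda>x y z a b. vector [0, 1, 0, 0, 0])"

definition X14 :: "real^5 \<Rightarrow> real^5" where
  "X14 = coord_field (\<lambda>x y z a b. vector [0, 0, 1, 0, 0])"

end

theory Submission
  imports Defs
begin

text \<open>A contact vector field \<open>X\<close> is determined by its generating function \<open>f = \<omega>\<^sup>0(X)\<close>. Preserving \<open>\<Upsilon>\<close> up
  to scale on the contact distribution means that \<open>X\<close> acts there through the irreducible \<open>\<gg>\<ll>(2)\<close>,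
  which is a system of linear second order equations for \<open>f\<close>. Prolonging the system yields 14 functions,
  namely \<open>f\<close> and 13 of its higher derivatives, whose first derivatives are linear combinations of these
  same functions, so \<open>f\<close> is determined by 14 numbers at the origin and 14 independent symmetries span
  everything. In this basis \<open>X5\<close> and \<open>X8\<close>
  act diagonally and the eigenvalues form the root system of type \<open>G\<^sub>2\<close>. Simplicity follows from the
  contact grading: brackets with \<open>X10, \<dots>, X14\<close> move any nonzero element of an ideal down to a multiple of
  \<open>X14\<close>, and brackets with \<open>X14\<close> lead back to everything.\<close>

section \<open>Smooth functions\<close>

text \<open>The computations use the contact frame instead of the coordinate fields: along it the
  equations for the generating function have constant coefficients, and the only nonzero brackets of
  the frame are constant multiples of the Reeb field, so each integrability condition is a short
  linear calculation. There are seven second order equations because the contact condition already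
  confines the linear action to the conformal symplectic algebra, of dimension 11, in which
  \<gg>\<ll>(2) has dimension 4. The 14 numbers come in groups of 1, 4, 4, 4, 1 according to the
  order of differentiation, with the Reeb direction counted twice; these are the dimensions of the
  pieces of the contact grading. Its grading element is \<open>X5 + X8\<close>, which is minus the
  bracket of \<open>X1\<close> and \<open>X14\<close>: the degree is 2 on \<open>X1\<close>, 1 on
  \<open>X2\<close>, \<open>X3\<close>, \<open>X4\<close>, \<open>X6\<close>, 0 on
  \<open>X5\<close>, \<open>X7\<close>, \<open>X8\<close>, \<open>X9\<close>, -1 on
  \<open>X10\<close> to \<open>X13\<close>, and -2 on \<open>X14\<close>. The space of symmetries is
  not known in advance to have finite dimension, and derivatives behave linearly only on smooth
  maps, so the dimension count uses a map that is linear on that subspace alone.\<close>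

lemma frechet_derivative_eqI: "(f has_derivative f') (at p) \<Longrightarrow> frechet_derivative f (at p) = f'"
  by (metis frechet_derivative_at)

lemma has_derivative_frechet:
  "f differentiable (at p) \<Longrightarrow> (f has_derivative frechet_derivative f (at p)) (at p)"
  by (simp add: frechet_derivative_works[symmetric])

lemma times_cont_differentiable_Suc_imp:
  "times_cont_differentiable (Suc k) f \<Longrightarrow> times_cont_differentiable k f"
  by (induction k arbitrary: f) (auto intro: differentiable_imp_continuous_on)

lemma times_cont_differentiable_bounded_linear_comp:
  assumes "bounded_linear L"
  shows "times_cont_differentiable k f \<Longrightarrow> times_cont_differentiable k (\<lambda>p. L (f p))"
proof (induction k arbitrary: f)
  case 0
  then show ?case using assms by (simp add: bounded_linear.continuous_on)
next
  case (Suc k)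
  then have d: "f differentiable (at p)" for p
    by (simp add: differentiable_on_def)
  have D: "((\<lambda>p. L (f p)) has_derivative (\<lambda>v. L (frechet_derivative f (at p) v))) (at p)" for p
    using bounded_linear.has_derivative[OF assms has_derivative_frechet[OF d]] .
  show ?case
    using Suc D unfolding times_cont_differentiable.simps
    by (auto simp: frechet_derivative_eqI[OF D] differentiable_on_def differentiable_def)
qed

lemma times_cont_differentiable_const: "times_cont_differentiable k (\<lambda>p. c)"
  by (induction k arbitrary: c) (auto simp: frechet_derivative_const)

lemma times_cont_differentiable_bounded_linear:
  assumes "bounded_linear L"
  shows "times_cont_differentiable k L"
proof (cases k)
  case 0
  then show ?thesis using assms by (simp add: linear_continuous_on)
next
  case (Suc m)
  have "(L has_derivative L) (at p)" for p
    using assms by (rule bounded_linear_imp_has_derivative)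
  then have "frechet_derivative L (at p) = L" for p
    by (rule frechet_derivative_eqI)
  then show ?thesis
    by (simp add: Suc times_cont_differentiable_const bounded_linear_imp_differentiable_on assms)
qed

lemma times_cont_differentiable_add:
  "times_cont_differentiable k f \<Longrightarrow> times_cont_differentiable k g \<Longrightarrow>
   times_cont_differentiable k (\<lambda>p. f p + g p)"
proof (induction k arbitrary: f g)
  case 0
  then show ?case by (simp add: continuous_on_add)
next
  case (Suc k)
  then have d: "f differentiable (at p)" "g differentiable (at p)" for p
    by (simp_all add: differentiable_on_def)
  have D: "((\<lambda>p. f p + g p) has_derivative
      (\<lambda>v. frechet_derivative f (at p) v + frechet_derivative g (at p) v)) (at p)" for p
    by (intro has_derivative_add has_derivative_frechet d)
  show ?case
    using Suc D unfolding times_cont_differentiable.simps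
    by (auto simp: frechet_derivative_eqI[OF D] differentiable_on_def differentiable_def)
qed

text \<open>By the product rule the derivative mixes the factors with their derivatives, so the
  induction also needs the factors at the lower order.\<close>

lemma times_cont_differentiable_mult:
  fixes f g :: "'a::euclidean_space \<Rightarrow> real"
  shows "times_cont_differentiable k f \<Longrightarrow> times_cont_differentiable k g \<Longrightarrow>
   times_cont_differentiable k (\<lambda>p. f p * g p)"
proof (induction k arbitrary: f g)
  case 0
  then show ?case by (simp add: continuous_on_mult)
next
  case (Suc k)
  then have d: "f differentiable (at p)" "g differentiable (at p)" for p
    by (simp_all add: differentiable_on_def)
  have D: "((\<lambda>p. f p * g p) has_derivative
      (\<lambda>v. f p * frechet_derivative g (at p) v + frechet_derivative f (at p) v * g p)) (at p)" for p
    by (intro has_derivative_mult has_derivative_frechet d)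
  have "times_cont_differentiable k f" "times_cont_differentiable k g"
    using Suc.prems times_cont_differentiable_Suc_imp by blast+
  then have "times_cont_differentiable k
      (\<lambda>p. f p * frechet_derivative g (at p) v + frechet_derivative f (at p) v * g p)" for v
    using Suc by (intro times_cont_differentiable_add Suc.IH) auto
  then show ?case
    using D unfolding times_cont_differentiable.simps
    by (auto simp: frechet_derivative_eqI[OF D] differentiable_on_def differentiable_def)
qed

lemma smooth_const [intro!]: "smooth (\<lambda>p. c)"
  by (simp add: smooth_def times_cont_differentiable_const)

lemma smooth_bounded_linear: "bounded_linear L \<Longrightarrow> smooth L"
  by (simp add: smooth_def times_cont_differentiable_bounded_linear)

lemma smooth_bounded_linear_comp: "bounded_linear L \<Longrightarrow> smooth f \<Longrightarrow> smooth (\<lambda>p. L (f p))"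
  by (simp add: smooth_def times_cont_differentiable_bounded_linear_comp)

lemma smooth_add [intro!]: "smooth f \<Longrightarrow> smooth g \<Longrightarrow> smooth (\<lambda>p. f p + g p)"
  by (simp add: smooth_def times_cont_differentiable_add)

lemma smooth_mult [intro!]:
  fixes f g :: "'a::euclidean_space \<Rightarrow> real"
  shows "smooth f \<Longrightarrow> smooth g \<Longrightarrow> smooth (\<lambda>p. f p * g p)"
  by (simp add: smooth_def times_cont_differentiable_mult)

lemma smooth_scaleR: "smooth f \<Longrightarrow> smooth (\<lambda>p. c *\<^sub>R f p)"
  by (rule smooth_bounded_linear_comp[OF bounded_linear_scaleR_right])

lemma smooth_minus [intro!]: "smooth f \<Longrightarrow> smooth (\<lambda>p. - f p)"
  by (rule smooth_bounded_linear_comp[OF bounded_linear_minus[OF bounded_linear_ident]])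

lemma smooth_diff [intro!]: "smooth f \<Longrightarrow> smooth g \<Longrightarrow> smooth (\<lambda>p. f p - g p)"
  using smooth_add[OF _ smooth_minus, of f g] by simp

lemma smooth_divide [intro!]:
  fixes f :: "'a::euclidean_space \<Rightarrow> real"
  shows "smooth f \<Longrightarrow> smooth (\<lambda>p. f p / c)"
  using smooth_mult[OF _ smooth_const, of f "inverse c"] by (simp add: divide_inverse)

lemma smooth_power [intro!]:
  fixes f :: "'a::euclidean_space \<Rightarrow> real"
  shows "smooth f \<Longrightarrow> smooth (\<lambda>p. f p ^ n)"
  by (induction n) auto

lemma smooth_sum [intro!]: "(\<And>i. i \<in> A \<Longrightarrow> smooth (f i)) \<Longrightarrow> smooth (\<lambda>p. \<Sum>i\<in>A. f i p)"
  by (induction A rule: infinite_finite_induct) auto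

lemma smooth_vec_nth [intro!]:
  fixes f :: "'a::euclidean_space \<Rightarrow> real^'n"
  shows "smooth f \<Longrightarrow> smooth (\<lambda>p. f p $ i)"
  by (rule smooth_bounded_linear_comp[OF bounded_linear_vec_nth])

lemma smooth_ident [intro!]: "smooth (\<lambda>p. p)"
  by (rule smooth_bounded_linear[OF bounded_linear_ident])

lemma smooth_frechet_derivative [intro!]:
  "smooth f \<Longrightarrow> smooth (\<lambda>p. frechet_derivative f (at p) v)"
  unfolding smooth_def using times_cont_differentiable.simps(2) by blast

lemma smooth_imp_continuous: "smooth f \<Longrightarrow> continuous_on UNIV f"
  unfolding smooth_def using times_cont_differentiable.simps(1) by blast

lemma smooth_imp_differentiable: "smooth f \<Longrightarrow> f differentiable (at p)"
  unfolding smooth_def using times_cont_differentiable.simps(2)[of 0 f]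
  by (auto simp: differentiable_on_def)

lemma smooth_imp_has_derivative:
  "smooth f \<Longrightarrow> (f has_derivative frechet_derivative f (at p)) (at p)"
  by (intro has_derivative_frechet smooth_imp_differentiable)

lemma linear_frechet_derivative_smooth: "smooth f \<Longrightarrow> linear (frechet_derivative f (at p))"
  by (intro linear_frechet_derivative smooth_imp_differentiable)

lemma smooth_vecI:
  fixes f :: "'a::euclidean_space \<Rightarrow> real^'n"
  assumes "\<And>i. smooth (\<lambda>p. f p $ i)"
  shows "smooth f"
proof -
  have "smooth (\<lambda>p. \<Sum>i\<in>UNIV. f p $ i *\<^sub>R axis i (1::real))"
    by (intro smooth_sum smooth_bounded_linear_comp[OF bounded_linear_scaleR_left] assms)
  moreover have "(\<lambda>p. \<Sum>i\<in>UNIV. f p $ i *\<^sub>R axis i (1::real)) = f"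
    by (intro ext) (simp add: vec_eq_iff axis_def if_distrib cong: if_cong)
  ultimately show ?thesis by (simp only:)
qed

text \<open>Two applications of the mean value theorem express a second difference quotient as a value of
  either mixed derivative near the base point.\<close>

lemma second_difference_mean_value:
  fixes f :: "'a::euclidean_space \<Rightarrow> real"
  assumes "smooth f" "h > 0"
  obtains s t where "0 < s" "s < h" "0 < t" "t < h"
    "f (p + h *\<^sub>R u + h *\<^sub>R v) - f (p + h *\<^sub>R u) - f (p + h *\<^sub>R v) + f p
      = h^2 * frechet_derivative (\<lambda>q. frechet_derivative f (at q) u) (at (p + s *\<^sub>R u + t *\<^sub>R v)) v"
proof -
  have line: "((\<lambda>s. g (q + s *\<^sub>R w)) has_real_derivative frechet_derivative g (at (q
    + s *\<^sub>R w)) w) (at s)"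
    if "smooth g" for g :: "'a \<Rightarrow> real" and q w s
  proof -
    have "((\<lambda>s. q + s *\<^sub>R w) has_derivative (\<lambda>r. r *\<^sub>R w)) (at s)"
      by (auto intro!: derivative_eq_intros)
    from has_derivative_compose[OF this smooth_imp_has_derivative[OF that]]
    show ?thesis
      by (rule has_derivative_imp_has_field_derivative)
        (simp add: linear_cmul[OF linear_frechet_derivative_smooth[OF that]] mult.commute)
  qed
  define \<phi> where "\<phi> s = f ((p + h *\<^sub>R v) + s *\<^sub>R u) - f (p + s *\<^sub>R u)" for s
  have "\<exists>s. 0 < s \<and> s < h \<and> \<phi> h - \<phi> 0 = (h - 0) *
    (frechet_derivative f (at ((p + h *\<^sub>R v) + s *\<^sub>R u)) u - frechet_derivative f (at (p + s *\<^sub>R u)) u)"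
    unfolding \<phi>_def
    by (intro MVT2 DERIV_diff line assms)
  then obtain s where s: "0 < s" "s < h" "\<phi> h - \<phi> 0 = h *
    (frechet_derivative f (at ((p + h *\<^sub>R v) + s *\<^sub>R u)) u - frechet_derivative f (at (p + s *\<^sub>R u)) u)"
    by auto
  let ?g = "\<lambda>q. frechet_derivative f (at q) u"
  have "\<exists>t. 0 < t \<and> t < h \<and> ?g ((p + s *\<^sub>R u) + h *\<^sub>R v) - ?g ((p + s *\<^sub>R u) + 0 *\<^sub>R v)
     = (h - 0) * frechet_derivative ?g (at ((p + s *\<^sub>R u) + t *\<^sub>R v)) v"
    by (intro MVT2 line smooth_frechet_derivative assms)
  then obtain t where t: "0 < t" "t < h" "?g ((p + s *\<^sub>R u) + h *\<^sub>R v) - ?g (p + s *\<^sub>R u)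
     = h * frechet_derivative ?g (at ((p + s *\<^sub>R u) + t *\<^sub>R v)) v"
    by auto
  show ?thesis
  proof (rule that[OF s(1,2) t(1,2)])
    have "f (p + h *\<^sub>R u + h *\<^sub>R v) - f (p + h *\<^sub>R u) - f (p + h *\<^sub>R v) + f p = \<phi> h - \<phi> 0"
      by (simp add: \<phi>_def algebra_simps)
    also have "\<dots> = h * (?g ((p + s *\<^sub>R u) + h *\<^sub>R v) - ?g (p + s *\<^sub>R u))"
      unfolding s(3) by (simp add: algebra_simps)
    also have "\<dots> = h^2 * frechet_derivative ?g (at (p + s *\<^sub>R u + t *\<^sub>R v)) v"
      unfolding t(3) by (simp add: power2_eq_square)
    finally show "f (p + h *\<^sub>R u + h *\<^sub>R v) - f (p + h *\<^sub>R u) - f (p + h *\<^sub>R v) + f p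
      = h^2 * frechet_derivative ?g (at (p + s *\<^sub>R u + t *\<^sub>R v)) v" .
  qed
qed

text \<open>The second difference quotient is symmetric in \<open>u\<close> and \<open>v\<close>,
  and it equals a value of each mixed derivative at some nearby point. Continuity at
  \<open>p\<close> then makes the two mixed derivatives agree up to any \<epsilon>.\<close>

lemma second_frechet_derivative_commute_real:
  fixes f :: "'a::euclidean_space \<Rightarrow> real"
  assumes "smooth f"
  shows "frechet_derivative (\<lambda>q. frechet_derivative f (at q) u) (at p) v
       = frechet_derivative (\<lambda>q. frechet_derivative f (at q) v) (at p) u"
proof -
  define A where "A p = frechet_derivative (\<lambda>q. frechet_derivative f (at q) u) (at p) v" for p
  define B where "B p = frechet_derivative (\<lambda>q. frechet_derivative f (at q) v) (at p) u" for p
  have "continuous_on UNIV A" "continuous_on UNIV B"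
    unfolding A_def B_def using assms by (auto intro!: smooth_imp_continuous)
  then have cont: "isCont A p" "isCont B p"
    by (auto simp: continuous_on_eq_continuous_at)
  have "\<bar>A p - B p\<bar> < \<epsilon>" if "\<epsilon> > 0" for \<epsilon>
  proof -
    from cont that obtain d where d: "d > 0" "\<And>q. dist q p < d \<Longrightarrow> dist (A q) (A p) < \<epsilon>/2"
      "\<And>q. dist q p < d \<Longrightarrow> dist (B q) (B p) < \<epsilon>/2"
      unfolding continuous_at_eps_delta
      by (metis half_gt_zero min_less_iff_conj)
    define M where "M = norm u + norm v + 1"
    have M: "M > 0" unfolding M_def by (smt (verit) norm_ge_zero)
    \<comment> \<open>With this side length the whole parallelogram spanned by \<open>h\<close>
      times \<open>u\<close> and \<open>v\<close> stays within distance \<open>d\<close> of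
      \<open>p\<close>; the summand 1 in \<open>M\<close> covers \<open>u = v = 0\<close>.\<close>
    define h where "h = d / M"
    have h: "h > 0" using d M by (simp add: h_def)
    have near: "dist (p + s *\<^sub>R u + t *\<^sub>R v) p < d" if "0 < s" "s < h" "0 < t" "t < h" for s t
    proof -
      have "dist (p + s *\<^sub>R u + t *\<^sub>R v) p = norm (s *\<^sub>R u + t *\<^sub>R v)"
        by (simp add: dist_norm algebra_simps)
      also have "\<dots> \<le> s * norm u + t * norm v"
        using that norm_triangle_ineq[of "s *\<^sub>R u" "t *\<^sub>R v"] by simp
      also have "\<dots> \<le> h * norm u + h * norm v"
        using that by (intro add_mono mult_right_mono) auto
      also have "\<dots> < h * M" using h by (simp add: M_def algebra_simps)
      also have "\<dots> = d" using M by (simp add: h_def)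
      finally show ?thesis .
    qed
    obtain s t where st: "0 < s" "s < h" "0 < t" "t < h"
      "f (p + h *\<^sub>R u + h *\<^sub>R v) - f (p + h *\<^sub>R u) - f (p + h *\<^sub>R v) + f p
        = h^2 * A (p + s *\<^sub>R u + t *\<^sub>R v)"
      using second_difference_mean_value[OF assms h] unfolding A_def by blast
    obtain s' t' where st': "0 < s'" "s' < h" "0 < t'" "t' < h"
      "f (p + h *\<^sub>R v + h *\<^sub>R u) - f (p + h *\<^sub>R v) - f (p + h *\<^sub>R u) + f p
        = h^2 * B (p + s' *\<^sub>R v + t' *\<^sub>R u)"
      using second_difference_mean_value[OF assms h] unfolding B_def by blast
    have "p + h *\<^sub>R v + h *\<^sub>R u = p + h *\<^sub>R u + h *\<^sub>R v" by (simp add: algebra_simps)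
    with st(5) st'(5)[unfolded this] have
      "h^2 * A (p + s *\<^sub>R u + t *\<^sub>R v) = h^2 * B (p + s' *\<^sub>R v + t' *\<^sub>R u)"
      by linarith
    then have "A (p + s *\<^sub>R u + t *\<^sub>R v) = B (p + t' *\<^sub>R u + s' *\<^sub>R v)"
      using h by (simp add: algebra_simps)
    moreover have "dist (A (p + s *\<^sub>R u + t *\<^sub>R v)) (A p) < \<epsilon>/2"
      using d(2) near st by blast
    moreover have "dist (B (p + t' *\<^sub>R u + s' *\<^sub>R v)) (B p) < \<epsilon>/2"
      using d(3) near st' by blast
    ultimately show ?thesis unfolding dist_real_def by linarith
  qed
  then have "A p = B p" by (metis abs_0 less_irrefl right_minus_eq zero_less_abs_iff)
  then show ?thesis by (simp add: A_def B_def)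
qed

lemma frechet_derivative_bounded_linear_comp:
  assumes "bounded_linear L" "smooth f"
  shows "frechet_derivative (\<lambda>p. L (f p)) (at p) v = L (frechet_derivative f (at p) v)"
  using frechet_derivative_eqI[OF bounded_linear.has_derivative[OF assms(1)
    smooth_imp_has_derivative[OF assms(2)]]]
  by simp

lemma second_frechet_derivative_commute:
  fixes f :: "'a::euclidean_space \<Rightarrow> 'b::euclidean_space"
  assumes "smooth f"
  shows "frechet_derivative (\<lambda>q. frechet_derivative f (at q) u) (at p) v
       = frechet_derivative (\<lambda>q. frechet_derivative f (at q) v) (at p) u"
proof (rule euclidean_eqI)
  fix b :: 'b
  have L: "bounded_linear (\<lambda>x. x \<bullet> b)" by (rule bounded_linear_inner_left)
  have "smooth (\<lambda>q. f q \<bullet> b)" by (rule smooth_bounded_linear_comp[OF L assms])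
  from second_frechet_derivative_commute_real[OF this, of u p v]
  show "frechet_derivative (\<lambda>q. frechet_derivative f (at q) u) (at p) v \<bullet> b
       = frechet_derivative (\<lambda>q. frechet_derivative f (at q) v) (at p) u \<bullet> b"
    by (simp add: frechet_derivative_bounded_linear_comp[OF L] assms smooth_frechet_derivative)
qed

section \<open>The quartic form and the contact frame\<close>

lemma exhaust_5:
  fixes x :: 5
  shows "x = 1 \<or> x = 2 \<or> x = 3 \<or> x = 4 \<or> x = 5"
proof (induct x)
  case (of_int z)
  then have "z = 0 \<or> z = 1 \<or> z = 2 \<or> z = 3 \<or> z = 4" by fastforce
  then show ?case by auto
qed

lemma forall_5: "(\<forall>i::5. P i) \<longleftrightarrow> P 1 \<and> P 2 \<and> P 3 \<and> P 4 \<and> P 5"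
  by (metis exhaust_5)

lemma vector_5 [simp]:
  "(vector [v, w, x, y, z] :: 'a::zero^5) $ 1 = v"
  "(vector [v, w, x, y, z] :: 'a^5) $ 2 = w"
  "(vector [v, w, x, y, z] :: 'a^5) $ 3 = x"
  "(vector [v, w, x, y, z] :: 'a^5) $ 4 = y"
  "(vector [v, w, x, y, z] :: 'a^5) $ 5 = z"
  unfolding vector_def by simp_all

text \<open>The contraction of \<open>Upsilon\<close> with the first coordinate vector, that is, the
  polarization of a quarter of the partial derivative of the quartic. The other three belong to
  coordinates 2, 4 and 5; coordinate 3 is missing because \<open>Upsilon\<close> does not involve
  dz.\<close>

definition polar1 :: "real^5 \<Rightarrow> real^5 \<Rightarrow> real^5 \<Rightarrow> real" where
  "polar1 t u v = t$5 * u$5 * v$5 / 27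
     - (t$4 * (v$2 * u$5 + v$5 * u$2) + u$4 * (v$2 * t$5 + v$5 * t$2) + v$4 * (u$2 * t$5 + u$5 * t$2)) / 12
     - (t$1 * u$4 * v$4 + u$1 * t$4 * v$4 + v$1 * t$4 * u$4) / 6"

definition polar2 :: "real^5 \<Rightarrow> real^5 \<Rightarrow> real^5 \<Rightarrow> real" where
  "polar2 t u v = (t$2 * u$5 * v$5 + u$2 * t$5 * v$5 + v$2 * t$5 * u$5) / 18
     - (t$4 * u$2 * v$2 + u$4 * t$2 * v$2 + v$4 * t$2 * u$2)
     - ((t$1 * u$4 + t$4 * u$1) * v$5 + (t$1 * v$4 + t$4 * v$1) * u$5 + (u$1 * v$4 + u$4 * v$1) * t$5) / 12"

definition polar4 :: "real^5 \<Rightarrow> real^5 \<Rightarrow> real^5 \<Rightarrow> real" where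
  "polar4 t u v = - t$2 * u$2 * v$2
     - (t$1 * (v$2 * u$5 + v$5 * u$2) + u$1 * (v$2 * t$5 + v$5 * t$2) + v$1 * (u$2 * t$5 + u$5 * t$2)) / 12
     - (t$1 * u$1 * v$4 + t$1 * v$1 * u$4 + u$1 * v$1 * t$4) / 6"

definition polar5 :: "real^5 \<Rightarrow> real^5 \<Rightarrow> real^5 \<Rightarrow> real" where
  "polar5 t u v = (t$2 * u$2 * v$5 + t$2 * v$2 * u$5 + u$2 * v$2 * t$5) / 18
     + (t$1 * u$5 * v$5 + u$1 * t$5 * v$5 + v$1 * t$5 * u$5) / 27
     - ((t$1 * u$4 + t$4 * u$1) * v$2 + (t$1 * v$4 + t$4 * v$1) * u$2 + (u$1 * v$4 + u$4 * v$1) * t$2) / 12"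

lemmas polar_defs = polar1_def polar2_def polar4_def polar5_def

text \<open>The quartic has constant coefficients in these coordinates, so nothing on the right
  depends on \<open>p\<close>. Splitting off the last slot replaces one large quartic identity by
  four cubic ones.\<close>

lemma Upsilon_polar:
  "Upsilon p [t, u, v, w] =
     w$1 * polar1 t u v + w$2 * polar2 t u v + w$4 * polar4 t u v + w$5 * polar5 t u v"
  by (simp add: Upsilon_def omega1_def omega2_def omega3_def omega4_def d_coord_def sym_prod_def
    scaleR_fun_def lessThan_Suc numeral_eq_Suc) (simp add: polar_defs field_simps)

text \<open>The parameters are the coefficients of the linear parts of \<open>X7\<close>, \<open>X9\<close>, \<open>X5\<close> and \<open>X8\<close> in their
  action on \<open>(\<omega>\<^sup>1, \<dots>, \<omega>\<^sup>4)\<close>; together they form the irreducible 4-dimensional representation of \<open>\<gg>\<ll>(2)\<close>.\<close>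

definition gl2_action :: "real \<Rightarrow> real \<Rightarrow> real \<Rightarrow> real \<Rightarrow> real^5 \<Rightarrow> real^5" where
  "gl2_action \<alpha> \<beta> \<gamma> \<delta> v = vector
     [\<delta> * v $ 1 + \<beta> * v $ 2, - \<alpha> * v $ 1 + (\<gamma> + 2 * \<delta>) / 3 * v $ 2 - 2 / 9 * \<beta> * v $ 5, 0,
      \<alpha> * v $ 5 + \<gamma> * v $ 4, 6 * \<alpha> * v $ 2 + (2 * \<gamma> + \<delta>) / 3 * v $ 5 - \<beta> * v $ 4]"

text \<open>Invariance of \<open>Upsilon\<close> with factor 2 (\<gamma> + \<delta>), tested with a
  coordinate vector in the last slot: the right side is that multiple of the cubic minus the
  contraction of \<open>Upsilon\<close> with the image of the coordinate vector. The next three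
  lemmas do the same for the other slots.\<close>

lemma polar1_gl2_action:
 "polar1 (gl2_action \<alpha> \<beta> \<gamma> \<delta> t) u v + polar1 t (gl2_action \<alpha> \<beta> \<gamma> \<delta> u) v
   + polar1 t u (gl2_action \<alpha> \<beta> \<gamma> \<delta> v) = (2 * \<gamma> + \<delta>) * polar1 t u v + \<alpha> * polar2 t u v"
 by (simp add: polar_defs gl2_action_def field_simps)

lemma polar2_gl2_action:
 "polar2 (gl2_action \<alpha> \<beta> \<gamma> \<delta> t) u v + polar2 t (gl2_action \<alpha> \<beta> \<gamma> \<delta> u) v
   + polar2 t u (gl2_action \<alpha> \<beta> \<gamma> \<delta> v)
   = (5 * \<gamma> + 4 * \<delta>) / 3 * polar2 t u v - \<beta> * polar1 t u v - 6 * \<alpha> * polar5 t u v"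
 by (simp add: polar_defs gl2_action_def field_simps)

lemma polar4_gl2_action:
 "polar4 (gl2_action \<alpha> \<beta> \<gamma> \<delta> t) u v + polar4 t (gl2_action \<alpha> \<beta> \<gamma> \<delta> u) v
   + polar4 t u (gl2_action \<alpha> \<beta> \<gamma> \<delta> v)
   = (\<gamma> + 2 * \<delta>) * polar4 t u v + \<beta> * polar5 t u v"
 by (simp add: polar_defs gl2_action_def field_simps)

lemma polar5_gl2_action:
 "polar5 (gl2_action \<alpha> \<beta> \<gamma> \<delta> t) u v + polar5 t (gl2_action \<alpha> \<beta> \<gamma> \<delta> u) v
   + polar5 t u (gl2_action \<alpha> \<beta> \<gamma> \<delta> v)
   = (4 * \<gamma> + 5 * \<delta>) / 3 * polar5 t u v + 2 / 9 * \<beta> * polar2 t u v - \<alpha> * polar4 t u v"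
 by (simp add: polar_defs gl2_action_def field_simps)

text \<open>The action on the last argument is the transpose of what the four cubic identities
  produce, so all terms cancel except the scaling. The factor can be read off from the square of
  \<open>omega1\<close> times \<open>omega4\<close>, where \<delta> and \<gamma> each count
  twice.\<close>

lemma Upsilon_gl2_action:
  "Upsilon p [gl2_action \<alpha> \<beta> \<gamma> \<delta> t, u, v, w] + Upsilon p [t, gl2_action \<alpha> \<beta> \<gamma> \<delta> u, v, w]
   + Upsilon p [t, u, gl2_action \<alpha> \<beta> \<gamma> \<delta> v, w] + Upsilon p [t, u, v, gl2_action \<alpha> \<beta> \<gamma> \<delta> w]
   = 2 * (\<gamma> + \<delta>) * Upsilon p [t, u, v, w]" (is "?L = ?R")
proof -
  let ?S = "\<lambda>f. f (gl2_action \<alpha> \<beta> \<gamma> \<delta> t) u v + f t (gl2_action \<alpha> \<beta> \<gamma> \<delta> u) v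
    + f t u (gl2_action \<alpha> \<beta> \<gamma> \<delta> v)"
  let ?w = "gl2_action \<alpha> \<beta> \<gamma> \<delta> w"
  have "?L = w$1 * ?S polar1 + w$2 * ?S polar2 + w$4 * ?S polar4 + w$5 * ?S polar5
    + (?w$1 * polar1 t u v + ?w$2 * polar2 t u v + ?w$4 * polar4 t u v + ?w$5 * polar5 t u v)"
    unfolding Upsilon_polar by (simp add: distrib_left)
  also have "\<dots> = ?R"
    unfolding polar1_gl2_action polar2_gl2_action polar4_gl2_action polar5_gl2_action Upsilon_polar
    by (simp add: gl2_action_def field_simps)
  finally show ?thesis .
qed

text \<open>The factor \<open>- 3\<close> in \<open>frame3\<close> makes the frame dual to \<open>\<omega>\<^sup>1, \<dots>, \<omega>\<^sup>4\<close>.\<close>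

definition frame1 :: "real^5 \<Rightarrow> real^5" where "frame1 p = vector [1, 0, p $ 4, 0, 0]"
definition frame2 :: "real^5 \<Rightarrow> real^5" where "frame2 p = vector [0, 1, p $ 5, 0, 0]"
definition frame3 :: "real^5" where "frame3 = vector [0, 0, 0, 0, - 3]"
definition frame4 :: "real^5" where "frame4 = vector [0, 0, 0, 1, 0]"
definition reeb :: "real^5" where "reeb = vector [0, 0, 1, 0, 0]"

lemmas frame_defs = frame1_def frame2_def frame3_def frame4_def reeb_def

lemma omega0_1: "omega0 p [v] = v $ 3 - p $ 4 * v $ 1 - p $ 5 * v $ 2"
  by (simp add: omega0_def d_coord_def)

lemma frame_expansion:
  "v $ 1 *\<^sub>R frame1 p + v $ 2 *\<^sub>R frame2 p + (- v $ 5 / 3) *\<^sub>R frame3 + v $ 4 *\<^sub>R frame4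
     + omega0 p [v] *\<^sub>R reeb = v"
  by (simp add: vec_eq_iff forall_5 frame_defs omega0_1)

section \<open>The symmetry condition at a single point\<close>

lemma lie_derivative_omega0:
  "lie_derivative X omega0 p [v] =
     omega0 p [frechet_derivative X (at p) v] - X p $ 4 * v $ 1 - X p $ 5 * v $ 2"
proof -
  have "((\<lambda>q::real^5. v $ 3 - q $ 4 * v $ 1 - q $ 5 * v $ 2) has_derivative
     (\<lambda>w. - w $ 4 * v $ 1 - w $ 5 * v $ 2)) (at p)"
    by (auto intro!: derivative_eq_intros bounded_linear.has_derivative[OF bounded_linear_vec_nth])
  from frechet_derivative_eqI[OF this] show ?thesis
    by (simp add: lie_derivative_def omega0_1)
qed

text \<open>The coefficients of \<open>Upsilon\<close> are constant, so the term that differentiates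
  the tensor itself vanishes.\<close>

lemma lie_derivative_Upsilon:
  "lie_derivative X Upsilon p [t, u, v, w] =
     (let D = frechet_derivative X (at p) in
      Upsilon p [D t, u, v, w] + Upsilon p [t, D u, v, w]
      + Upsilon p [t, u, D v, w] + Upsilon p [t, u, v, D w])"
  by (simp add: lie_derivative_def Upsilon_polar Let_def numeral_eq_Suc lessThan_Suc frechet_derivative_const)

lemma Upsilon_swap:
  "Upsilon p [t, u, v, w] = Upsilon p [u, t, v, w]"
  "Upsilon p [t, u, v, w] = Upsilon p [t, v, u, w]"
  "Upsilon p [t, u, v, w] = Upsilon p [t, u, w, v]"
  unfolding Upsilon_polar by (simp_all add: polar_defs algebra_simps add_divide_distrib)

lemma Upsilon_linear4:
  "Upsilon p [t, u, v, w + c *\<^sub>R w'] = Upsilon p [t, u, v, w] + c * Upsilon p [t, u, v, w']"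
  unfolding Upsilon_polar by (simp add: algebra_simps)

text \<open>The added vector always ends up in the first slot. There \<open>Upsilon_reeb\<close>
  removes multiples of the Reeb vector, and the remaining terms have the shape of a contraction with
  one fixed vector.\<close>

lemma Upsilon_linear:
  "Upsilon p [t + c *\<^sub>R t', u, v, w] = Upsilon p [t, u, v, w] + c * Upsilon p [t', u, v, w]"
  "Upsilon p [t, u + c *\<^sub>R t', v, w] = Upsilon p [t, u, v, w] + c * Upsilon p [t', t, v, w]"
  "Upsilon p [t, u, v + c *\<^sub>R t', w] = Upsilon p [t, u, v, w] + c * Upsilon p [t', t, u, w]"
  "Upsilon p [t, u, v, w + c *\<^sub>R t'] = Upsilon p [t, u, v, w] + c * Upsilon p [t', t, u, v]"
  by (metis Upsilon_swap Upsilon_linear4)+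

text \<open>The infinitesimal symmetry condition at \<open>p\<close> for a field with value \<open>w\<close> and derivative \<open>D\<close>
  there: the flow preserves the contact distribution, on which \<open>D\<close> acts through \<^term>\<open>gl2_action\<close>.\<close>

definition symmetry_equations :: "real^5 \<Rightarrow> real^5 \<Rightarrow> (real^5 \<Rightarrow> real^5) \<Rightarrow> bool" where
  "symmetry_equations p w D \<longleftrightarrow>
     omega0 p [D (frame1 p)] = w $ 4 \<and> omega0 p [D (frame2 p)] = w $ 5 \<and>
     omega0 p [D frame3] = 0 \<and> omega0 p [D frame4] = 0 \<and>
     D frame3 $ 1 = 0 \<and> D frame4 $ 1 = 0 \<and> D frame4 $ 2 = 0 \<and>
     D (frame1 p) $ 5 = 0 \<and> D (frame1 p) $ 4 = 0 \<and> D (frame2 p) $ 4 = 0 \<and>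
     3 * D frame3 $ 2 = 2 * D (frame2 p) $ 1 \<and> D frame4 $ 5 = - D (frame2 p) $ 1 \<and>
     D (frame2 p) $ 5 = - 6 * D (frame1 p) $ 2 \<and> D frame3 $ 4 = 3 * D (frame1 p) $ 2 \<and>
     3 * D (frame2 p) $ 2 = D frame4 $ 4 + 2 * D (frame1 p) $ 1 \<and>
     - D frame3 $ 5 = 2 * D frame4 $ 4 + D (frame1 p) $ 1"

text \<open>Apart from the four conditions on \<open>omega0\<close>, the twelve equations cut the 16
  entries of \<open>D\<close> on the frame down to 4, which are the \<gg>\<ll>(2) parameters read
  off here. Along the Reeb direction \<open>D\<close> stays arbitrary, hence the last summand;
  \<open>r\<close> absorbs the z-components.\<close>

lemma symmetry_equations_action:
  assumes "symmetry_equations p w D" "linear D"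
  shows "\<exists>r. D v = (gl2_action (- D (frame1 p) $ 2) (D (frame2 p) $ 1) (D frame4 $ 4) (D (frame1 p) $ 1) v
      + r *\<^sub>R reeb) + omega0 p [v] *\<^sub>R D reeb"
proof -
  have "D v = v $ 1 *\<^sub>R D (frame1 p) + v $ 2 *\<^sub>R D (frame2 p) + (- v $ 5 / 3) *\<^sub>R D frame3
      + v $ 4 *\<^sub>R D frame4 + omega0 p [v] *\<^sub>R D reeb"
    by (subst frame_expansion[symmetric, of v p])
      (simp only: linear_add[OF assms(2)] linear_cmul[OF assms(2)])
  moreover have "D frame3 $ 1 = 0" "D frame4 $ 1 = 0" "D frame4 $ 2 = 0"
    "D (frame1 p) $ 5 = 0" "D (frame1 p) $ 4 = 0" "D (frame2 p) $ 4 = 0"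
    "D frame3 $ 2 = 2 / 3 * D (frame2 p) $ 1" "D frame4 $ 5 = - D (frame2 p) $ 1"
    "D (frame2 p) $ 5 = - 6 * D (frame1 p) $ 2" "D frame3 $ 4 = 3 * D (frame1 p) $ 2"
    "D (frame2 p) $ 2 = (D frame4 $ 4 + 2 * D (frame1 p) $ 1) / 3"
    "D frame3 $ 5 = - (2 * D frame4 $ 4 + D (frame1 p) $ 1)"
    using assms(1) by (simp_all add: symmetry_equations_def)
  ultimately show ?thesis
    by (intro exI[of _ "v $ 1 * D (frame1 p) $ 3 + v $ 2 * D (frame2 p) $ 3
      + (- v $ 5 / 3) * D frame3 $ 3
      + v $ 4 * D frame4 $ 3"])
     (simp add: vec_eq_iff forall_5 gl2_action_def, simp add: reeb_def field_simps)
qed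

lemma Upsilon_reeb: "Upsilon p [reeb, t, u, v] = 0"
  by (simp add: Upsilon_polar polar_defs reeb_def)

lemma symmetry_equations_Upsilon:
  assumes "symmetry_equations p w D" "linear D"
  shows "Upsilon p [D t, u, v, x] + Upsilon p [t, D u, v, x] + Upsilon p [t, u, D v, x]
    + Upsilon p [t, u, v, D x]
   = 2 * (D frame4 $ 4 + D (frame1 p) $ 1) * Upsilon p [t, u, v, x]
     + omega0 p [t] * Upsilon p [D reeb, u, v, x] + omega0 p [u] * Upsilon p [D reeb, t, v, x]
     + omega0 p [v] * Upsilon p [D reeb, t, u, x] + omega0 p [x] * Upsilon p [D reeb, t, u, v]"
proof -
  note act = symmetry_equations_action[OF assms]
  obtain r1 r2 r3 r4 where
    "D t = (gl2_action (- D (frame1 p) $ 2) (D (frame2 p) $ 1) (D frame4 $ 4) (D (frame1 p) $ 1) t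
      + r1 *\<^sub>R reeb) + omega0 p [t] *\<^sub>R D reeb"
    "D u = (gl2_action (- D (frame1 p) $ 2) (D (frame2 p) $ 1) (D frame4 $ 4) (D (frame1 p) $ 1) u
      + r2 *\<^sub>R reeb) + omega0 p [u] *\<^sub>R D reeb"
    "D v = (gl2_action (- D (frame1 p) $ 2) (D (frame2 p) $ 1) (D frame4 $ 4) (D (frame1 p) $ 1) v
      + r3 *\<^sub>R reeb) + omega0 p [v] *\<^sub>R D reeb"
    "D x = (gl2_action (- D (frame1 p) $ 2) (D (frame2 p) $ 1) (D frame4 $ 4) (D (frame1 p) $ 1) x
      + r4 *\<^sub>R reeb) + omega0 p [x] *\<^sub>R D reeb"
    using act[of t] act[of u] act[of v] act[of x] by blast
  then show ?thesis
    using Upsilon_gl2_action[of p "- D (frame1 p) $ 2" "D (frame2 p) $ 1" "D frame4 $ 4"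
      "D (frame1 p) $ 1" t u v x]
    by (simp only: Upsilon_linear Upsilon_reeb)
qed

text \<open>On the four frame vectors the contact equations cancel the correction terms of the Lie
  derivative, so only the Reeb component of \<open>v\<close> contributes.\<close>

lemma symmetry_equations_contact:
  assumes "symmetry_equations p (X p) (frechet_derivative X (at p))"
    "linear (frechet_derivative X (at p))"
  shows "lie_derivative X omega0 p [v] = omega0 p [frechet_derivative X (at p) reeb] * omega0 p [v]"
proof -
  let ?D = "frechet_derivative X (at p)"
  have lin: "omega0 p [a - b] = omega0 p [a] - omega0 p [b]"
    "omega0 p [a + b] = omega0 p [a] + omega0 p [b]" "omega0 p [c *\<^sub>R a] = c * omega0 p [a]" for a b c
    by (simp_all add: omega0_1 algebra_simps)
  have "?D v = v $ 1 *\<^sub>R ?D (frame1 p) + v $ 2 *\<^sub>R ?D (frame2 p) + (- v $ 5 / 3) *\<^sub>R ?D frame3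
      + v $ 4 *\<^sub>R ?D frame4 + omega0 p [v] *\<^sub>R ?D reeb"
    by (subst frame_expansion[symmetric, of v p])
      (simp only: linear_add[OF assms(2)] linear_cmul[OF assms(2)])
  then have "omega0 p [?D v] = v $ 1 * X p $ 4 + v $ 2 * X p $ 5 + omega0 p [v] * omega0 p [?D reeb]"
    using assms(1) by (simp add: lin symmetry_equations_def)
  then show ?thesis by (simp add: lie_derivative_omega0)
qed

section \<open>Infinitesimal symmetries as solutions of pointwise equations\<close>

lemma list_of_length:
  "length vs = 2 \<Longrightarrow> \<exists>a b. vs = [a, b]"
  "length vs = 3 \<Longrightarrow> \<exists>a b c. vs = [a, b, c]"
  "length vs = 4 \<Longrightarrow> \<exists>a b c d. vs = [a, b, c, d]"
  by (auto simp: numeral_eq_Suc length_Suc_conv)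

text \<open>Two adjacent transpositions generate all permutations of three arguments, and linearity
  in one slot then passes to the others.\<close>

lemma symmetric_tensor_field_3I:
  assumes "\<And>a b c. smooth (\<lambda>p. T p [a, b, c])"
    and "\<And>p b c. linear (\<lambda>a. T p [a, b, c])"
    and "\<And>p a b c. T p [a, b, c] = T p [b, a, c]"
    and "\<And>p a b c. T p [a, b, c] = T p [a, c, b]"
  shows "symmetric_tensor_field 3 T"
  unfolding symmetric_tensor_field_def
proof (intro conjI allI impI; (elim conjE)?)
  fix vs :: "'a list" assume "length vs = 3"
  then show "smooth (\<lambda>p. T p vs)" using list_of_length(2) assms(1) by metis
next
  fix p and vs :: "'a list" and i :: nat assume *: "length vs = 3" "i < 3"
  then obtain a b c where vs: "vs = [a, b, c]" using list_of_length(2) by blast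
  have e: "(\<lambda>v. T p [a, v, c]) = (\<lambda>v. T p [v, a, c])" "(\<lambda>v. T p [a, b, v]) = (\<lambda>v. T p [v, a, b])"
    using assms(3,4) by metis+
  from * consider "i = 0" | "i = 1" | "i = 2" by linarith
  then show "linear (\<lambda>v. T p (vs[i := v]))"
    using assms(2) by cases (simp_all add: vs e)
next
  fix p and vs ws :: "'a list" assume *: "length vs = 3" "mset ws = mset vs"
  then have "length ws = 3" by (metis size_mset)
  with * obtain a b c a' b' c' where vs: "vs = [a, b, c]" and ws: "ws = [a', b', c']"
    using list_of_length(2) by metis
  have "(a' = a \<and> b' = b \<and> c' = c) \<or> (a' = a \<and> b' = c \<and> c' = b) \<or> (a' = b \<and> b' = a \<and> c' = c) \<or>
        (a' = b \<and> b' = c \<and> c' = a) \<or> (a' = c \<and> b' = a \<and> c' = b) \<or> (a' = c \<and> b' = b \<and> c' = a)"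
    using *(2) unfolding vs ws by (auto simp: add_eq_conv_ex add_mset_eq_singleton_iff)
  then show "T p ws = T p vs"
    unfolding vs ws using assms(3,4) by metis
qed

theorem symmetries_iff:
  "X \<in> infinitesimal_symmetries omega0 Upsilon \<longleftrightarrow>
     smooth X \<and> (\<forall>p. symmetry_equations p (X p) (frechet_derivative X (at p)))"
proof
  assume X: "X \<in> infinitesimal_symmetries omega0 Upsilon"
  then have sm: "smooth X" by (simp add: infinitesimal_symmetries_def)
  from X obtain h \<theta> where ups: "\<And>p vs. length vs = 4 \<Longrightarrow>
      lie_derivative X Upsilon p vs = h p * Upsilon p vs + (omega0 \<odot> \<theta>) p vs"
    by (auto simp: infinitesimal_symmetries_def)
  \<comment> \<open>Since \<open>omega0\<close> is 1 on \<open>reeb\<close>, pairing with it shows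
    that the Lie derivative of \<open>omega0\<close> vanishes on the contact distribution.\<close>
  have wedge: "wedge_1_forms (lie_derivative X omega0) omega0 p [v, reeb] = 0" for p v
    using X by (simp add: infinitesimal_symmetries_def)
  have "symmetry_equations p (X p) (frechet_derivative X (at p))" for p
  proof -
    define D where "D = frechet_derivative X (at p)"
    have c: "omega0 p [D v] = X p $ 4 * v $ 1 + X p $ 5 * v $ 2" if "omega0 p [v] = 0" for v
      using wedge[of p v] that
      by (simp add: wedge_1_forms_def lie_derivative_omega0 D_def[symmetric])
        (simp add: omega0_1 reeb_def)
    have u: "Upsilon p [D t, u, v, x] + Upsilon p [t, D u, v, x] + Upsilon p [t, u, D v, x]
      + Upsilon p [t, u, v, D x]
      = h p * Upsilon p [t, u, v, x]"
      if "omega0 p [t] = 0" "omega0 p [u] = 0" "omega0 p [v] = 0" "omega0 p [x] = 0" for t u v x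
      using ups[of "[t, u, v, x]" p] that
      by (simp add: lie_derivative_Upsilon
        D_def[symmetric] Let_def sym_prod_def lessThan_Suc numeral_eq_Suc)
    have k: "omega0 p [frame1 p] = 0" "omega0 p [frame2 p] = 0" "omega0 p [frame3] = 0"
      "omega0 p [frame4] = 0"
      by (simp_all add: omega0_1 frame_defs)
    \<comment> \<open>On the contact distribution the term with \<theta> drops out. Each quadruple
      of frame vectors below is chosen so that few monomials of the quartic respond: six entries
      vanish, four relations link off-diagonal entries, and three give \<open>h p\<close> in terms
      of diagonal entries. Eliminating \<open>h p\<close> leaves the two diagonal relations.\<close>
    note e = u[unfolded Upsilon_polar polar_defs]
    let ?f1 = "frame1 p" and ?f2 = "frame2 p"
    have 1: "D ?f1 $ 4 = 0" using e[OF k(1) k(1) k(1) k(4)] by (simp add: frame_defs)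
    have 2: "D frame4 $ 1 = 0" using e[OF k(1) k(4) k(4) k(4)] by (simp add: frame_defs)
    have 3: "D frame3 $ 1 = 0" using e[OF k(3) k(3) k(3) k(3)] by (simp add: frame_defs)
    have 4: "D ?f2 $ 4 = 0" using e[OF k(2) k(2) k(2) k(2)] by (simp add: frame_defs)
    have 5: "D ?f1 $ 5 = 0" using e[OF k(1) k(1) k(2) k(4)] 1 4 by (simp add: frame_defs)
    have 6: "D frame4 $ 2 = 0" using e[OF k(1) k(3) k(4) k(4)] 2 3 by (simp add: frame_defs)
    have 7: "D ?f2 $ 5 = - 2 * D frame3 $ 4"
      using e[OF k(2) k(2) k(2) k(3)] 4 by (simp add: frame_defs field_simps)
    have 8: "D frame3 $ 4 = 3 * D ?f1 $ 2"
      using e[OF k(1) k(1) k(3) k(4)] 1 2 3 4 5 6 by (simp add: frame_defs field_simps)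
    have 9: "3 * D frame3 $ 2 = 2 * D ?f2 $ 1"
      using e[OF k(2) k(3) k(3) k(3)] 1 2 3 4 5 6 by (simp add: frame_defs field_simps)
    have 10: "D frame4 $ 5 = - D ?f2 $ 1"
      using e[OF k(1) k(2) k(4) k(4)] 1 2 3 4 5 6 by (simp add: frame_defs field_simps)
    have 11: "2 * D ?f1 $ 1 + 2 * D frame4 $ 4 = h p"
      using e[OF k(1) k(1) k(4) k(4)] 1 2 3 4 5 6 by (simp add: frame_defs field_simps)
    have 12: "3 * D ?f2 $ 2 + D frame4 $ 4 = h p"
      using e[OF k(2) k(2) k(2) k(4)] 1 2 3 4 5 6 by (simp add: frame_defs field_simps)
    have 13: "D ?f1 $ 1 - D frame3 $ 5 = h p"
      using e[OF k(1) k(3) k(3) k(3)] 1 2 3 4 5 6 by (simp add: frame_defs field_simps)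
    show ?thesis
      unfolding symmetry_equations_def D_def[symmetric] using 1 2 3 4 5 6 7 8 9 10 11 12 13
      by (simp add: c k) (simp add: frame_defs)
  qed
  with sm show "smooth X \<and> (\<forall>p. symmetry_equations p (X p) (frechet_derivative X (at p)))" by blast
next
  assume X: "smooth X \<and> (\<forall>p. symmetry_equations p (X p) (frechet_derivative X (at p)))"
  then have sm: "smooth X" and eq: "symmetry_equations p (X p) (frechet_derivative X (at p))" for p
    by auto
  have lin: "linear (frechet_derivative X (at p))" for p
    using sm by (rule linear_frechet_derivative_smooth)
  define h where "h p = 2 * (frechet_derivative X (at p) frame4 $ 4
    + frechet_derivative X (at p) (frame1 p) $ 1)" for p
  \<comment> \<open>The factor 4 cancels the average over four arguments in \<open>sym_prod\<close>.
    What is contracted into \<open>Upsilon\<close> is the part of the derivative that the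
    \<gg>\<ll>(2) action does not control, its value on \<open>reeb\<close>.\<close>
  define \<theta> :: "(real^5) tensor_field" where
    "\<theta> p vs = 4 * Upsilon p (frechet_derivative X (at p) reeb # vs)" for p vs
  \<comment> \<open>\<open>frame1\<close> varies with the point; expanding it leaves derivatives in
    constant directions, which are smooth.\<close>
  have "frame1 p = axis 1 1 + p $ 4 *\<^sub>R reeb" for p
    by (simp add: vec_eq_iff forall_5 frame_defs axis_def)
  then have "h = (\<lambda>p. 2 * (frechet_derivative X (at p) frame4 $ 4
    + (frechet_derivative X (at p) (axis 1 1) $ 1
       + p $ 4 * frechet_derivative X (at p) reeb $ 1)))"
    by (intro ext) (simp add: h_def linear_add[OF lin] linear_cmul[OF lin])
  then have h: "smooth h" using sm by (auto simp only:)
  have \<theta>: "symmetric_tensor_field 3 \<theta>"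
  proof (rule symmetric_tensor_field_3I)
    fix a b c :: "real^5"
    \<comment> \<open>In the last slot \<open>Upsilon_polar\<close> separates the varying vector
      from cubic forms that are constant in \<open>p\<close>.\<close>
    have "Upsilon p [frechet_derivative X (at p) reeb, a, b, c]
      = Upsilon p [a, b, c, frechet_derivative X (at p) reeb]" for p
      by (metis Upsilon_swap)
    then have "(\<lambda>p. \<theta> p [a, b, c]) = (\<lambda>p. 4 * (frechet_derivative X (at p) reeb $ 1 * polar1 a b c
      + frechet_derivative X (at p) reeb $ 2 * polar2 a b c + frechet_derivative X (at p) reeb $ 4 * polar4 a b c
      + frechet_derivative X (at p) reeb $ 5 * polar5 a b c))"
      by (intro ext) (simp add: \<theta>_def Upsilon_polar)
    then show "smooth (\<lambda>p. \<theta> p [a, b, c])" using sm by (auto simp only:)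
  next
    fix p and b c :: "real^5"
    show "linear (\<lambda>a. \<theta> p [a, b, c])"
    proof (rule linearI)
      fix x y and r :: real
      let ?Z = "frechet_derivative X (at p) reeb"
      show "\<theta> p [x + y, b, c] = \<theta> p [x, b, c] + \<theta> p [y, b, c]"
        using Upsilon_linear(2)[of p ?Z x 1 y b c] Upsilon_swap(1)[of p y] by (simp add: \<theta>_def)
      show "\<theta> p [r *\<^sub>R x, b, c] = r *\<^sub>R \<theta> p [x, b, c]"
        using Upsilon_linear(2)[of p ?Z 0 r x b c] Upsilon_linear(2)[of p ?Z 0 1 0 b c] Upsilon_swap(1)[of p x] Upsilon_swap(1)[of p 0]
        by (simp add: \<theta>_def)
    qed
  qed (simp_all add: \<theta>_def, (metis Upsilon_swap)+)
  have "lie_derivative X Upsilon p vs = h p * Upsilon p vs + (omega0 \<odot> \<theta>) p vs" if vs: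
    "length vs = 4" for p vs
  proof -
    from vs obtain a b c d where "vs = [a, b, c, d]" using list_of_length(3) by blast
    then show ?thesis
      using symmetry_equations_Upsilon[OF eq[of p] lin[of p], of a b c d]
      by (simp add: lie_derivative_Upsilon Let_def sym_prod_def lessThan_Suc numeral_eq_Suc \<theta>_def h_def
          distrib_left)
  qed
  moreover have "wedge_1_forms (lie_derivative X omega0) omega0 p vs = 0" if vs: "length vs = 2"
    for p vs
    using symmetry_equations_contact[OF eq[of p] lin[of p]] by (simp add: wedge_1_forms_def)
  ultimately show "X \<in> infinitesimal_symmetries omega0 Upsilon"
    unfolding infinitesimal_symmetries_def using sm h \<theta> by blast
qed

section \<open>Generating functions\<close>

lemma scaleR_fun_apply: "(c *\<^sub>R f) p = c *\<^sub>R f p"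
  by (simp add: scaleR_fun_def)

lemma smooth_plus_fun [simp]: "smooth f \<Longrightarrow> smooth g \<Longrightarrow> smooth (f + g)"
  unfolding plus_fun_def by (rule smooth_add)

lemma smooth_scaleR_fun [simp]: "smooth f \<Longrightarrow> smooth (c *\<^sub>R f)"
  unfolding scaleR_fun_def by (rule smooth_scaleR)

lemma smooth_zero_fun [simp]: "smooth 0"
  unfolding zero_fun_def by (rule smooth_const)

lemma frechet_derivative_add_fun:
  "smooth f \<Longrightarrow> smooth g \<Longrightarrow>
   frechet_derivative (f + g) (at p) v = frechet_derivative f (at p) v + frechet_derivative g (at p) v"
  unfolding plus_fun_def
  by (simp add: frechet_derivative_eqI[OF
    has_derivative_add[OF smooth_imp_has_derivative smooth_imp_has_derivative]])

lemma frechet_derivative_scaleR_fun: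
  "smooth f \<Longrightarrow> frechet_derivative (c *\<^sub>R f) (at p) v = c *\<^sub>R frechet_derivative f (at p) v"
  unfolding scaleR_fun_def
  by (rule frechet_derivative_bounded_linear_comp[OF bounded_linear_scaleR_right])

section \<open>Derivatives along the contact frame\<close>

definition deriv_along :: "('a::euclidean_space \<Rightarrow> 'a) \<Rightarrow> ('a \<Rightarrow> real) \<Rightarrow> 'a \<Rightarrow> real" where
  "deriv_along V f = (\<lambda>p. frechet_derivative f (at p) (V p))"

abbreviation D1 where "D1 \<equiv> deriv_along frame1"
abbreviation D2 where "D2 \<equiv> deriv_along frame2"
abbreviation D3 where "D3 \<equiv> deriv_along (\<lambda>_. frame3)"
abbreviation D4 where "D4 \<equiv> deriv_along (\<lambda>_. frame4)"
abbreviation DZ where "DZ \<equiv> deriv_along (\<lambda>_. reeb)"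

lemma deriv_along_add [simp]:
  "smooth f \<Longrightarrow> smooth g \<Longrightarrow> deriv_along V (f + g) = deriv_along V f + deriv_along V g"
  by (simp add: deriv_along_def fun_eq_iff frechet_derivative_add_fun)

lemma deriv_along_scaleR [simp]:
  "smooth f \<Longrightarrow> deriv_along V (c *\<^sub>R f) = c *\<^sub>R deriv_along V f"
  by (simp add: deriv_along_def fun_eq_iff frechet_derivative_scaleR_fun scaleR_fun_apply)

lemma deriv_along_zero [simp]: "deriv_along V 0 = 0"
  unfolding zero_fun_def by (simp add: deriv_along_def frechet_derivative_const)

lemma smooth_minus_fun [simp]: "smooth f \<Longrightarrow> smooth g \<Longrightarrow> smooth (f - g)"
  unfolding fun_diff_def by (rule smooth_diff)

lemma deriv_along_minus [simp]:
  assumes "smooth f" "smooth g"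
  shows "deriv_along V (f - g) = deriv_along V f - deriv_along V g"
  using deriv_along_add[of "f - g" g V] assms by simp

lemma smooth_uminus_fun [simp]: "smooth f \<Longrightarrow> smooth (- f)"
  unfolding fun_Compl_def by (rule smooth_minus)

lemma deriv_along_uminus [simp]: "smooth f \<Longrightarrow> deriv_along V (- f) = - deriv_along V f"
  using deriv_along_minus[of 0 f V] by simp

lemma frame_affine:
  "frame1 p = axis 1 1 + p $ 4 *\<^sub>R reeb" "frame2 p = axis 2 1 + p $ 5 *\<^sub>R reeb"
  by (simp_all add: vec_eq_iff forall_5 frame_defs axis_def)

lemma D12_expand:
  assumes "smooth f"
  shows "D1 f p = frechet_derivative f (at p) (axis 1 1) + p $ 4 * frechet_derivative f (at p) reeb"
    and "D2 f p = frechet_derivative f (at p) (axis 2 1) + p $ 5 * frechet_derivative f (at p) reeb"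
  using linear_frechet_derivative_smooth[OF assms, of p]
  by (simp_all add: deriv_along_def frame_affine linear_add linear_cmul)

lemma smooth_deriv_along_const [simp]: "smooth f \<Longrightarrow> smooth (deriv_along (\<lambda>_. v) f)"
  unfolding deriv_along_def by (rule smooth_frechet_derivative)

lemma smooth_D12 [simp]:
  assumes "smooth f"
  shows "smooth (D1 f)" "smooth (D2 f)"
proof -
  have "D1 f = (\<lambda>p. frechet_derivative f (at p) (axis 1 1) + p $ 4 * frechet_derivative f (at p) reeb)"
    "D2 f = (\<lambda>p. frechet_derivative f (at p) (axis 2 1) + p $ 5 * frechet_derivative f (at p) reeb)"
    using D12_expand[OF assms] by auto
  then show "smooth (D1 f)" "smooth (D2 f)" using assms by (auto simp only:)
qed

lemma frechet_derivative_affine_comb: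
  fixes g h :: "real^'n \<Rightarrow> real"
  assumes "smooth g" "smooth h"
  shows "frechet_derivative (\<lambda>q. g q + q $ i * h q) (at p) v
     = frechet_derivative g (at p) v + (p $ i * frechet_derivative h (at p) v + v $ i * h p)"
proof -
  have "((\<lambda>q. g q + q $ i * h q) has_derivative (\<lambda>v. frechet_derivative g (at p) v
     + (p $ i * frechet_derivative h (at p) v + v $ i * h p))) (at p)"
    by (intro has_derivative_add has_derivative_mult smooth_imp_has_derivative assms
        bounded_linear_imp_has_derivative bounded_linear_vec_nth)
  from frechet_derivative_eqI[OF this] show ?thesis by simp
qed

text \<open>The first term treats the frame vector as frozen at \<open>p\<close>. The second comes
  from the motion of the frame: \<open>frame1\<close> and \<open>frame2\<close> change only by a
  multiple of \<open>reeb\<close>, with rates \<open>v $ 4\<close> and \<open>v $ 5\<close>.\<close>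

lemma frechet_derivative_D12:
  assumes "smooth f"
  shows "frechet_derivative (D1 f) (at p) v
    = frechet_derivative (\<lambda>q. frechet_derivative f (at q) v) (at p) (frame1 p)
      + v $ 4 * DZ f p"
    and "frechet_derivative (D2 f) (at p) v
      = frechet_derivative (\<lambda>q. frechet_derivative f (at q) v) (at p) (frame2 p)
      + v $ 5 * DZ f p"
proof -
  have e: "D1 f = (\<lambda>p. frechet_derivative f (at p) (axis 1 1)
    + p $ 4 * frechet_derivative f (at p) reeb)"
    "D2 f = (\<lambda>p. frechet_derivative f (at p) (axis 2 1) + p $ 5 * frechet_derivative f (at p) reeb)"
    using D12_expand[OF assms] by auto
  have s: "smooth (\<lambda>q. frechet_derivative f (at q) u)" for u using assms by auto
  have l: "linear (frechet_derivative (\<lambda>q. frechet_derivative f (at q) v) (at p))"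
    by (rule linear_frechet_derivative_smooth[OF s])
  note c = second_frechet_derivative_commute_real[OF assms, of _ p v]
  show "frechet_derivative (D1 f) (at p) v
    = frechet_derivative (\<lambda>q. frechet_derivative f (at q) v) (at p) (frame1 p)
      + v $ 4 * DZ f p"
    unfolding e frechet_derivative_affine_comb[OF s s] c frame_affine
    by (simp add: linear_add[OF l] linear_cmul[OF l] deriv_along_def)
  show "frechet_derivative (D2 f) (at p) v
    = frechet_derivative (\<lambda>q. frechet_derivative f (at q) v) (at p) (frame2 p)
      + v $ 5 * DZ f p"
    unfolding e frechet_derivative_affine_comb[OF s s] c frame_affine
    by (simp add: linear_add[OF l] linear_cmul[OF l] deriv_along_def)
qed

lemma deriv_along_const_D12:
  assumes "smooth f"
  shows "deriv_along (\<lambda>_. v) (D1 f) = D1 (deriv_along (\<lambda>_. v) f) + v $ 4 *\<^sub>R DZ f"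
    and "deriv_along (\<lambda>_. v) (D2 f) = D2 (deriv_along (\<lambda>_. v) f) + v $ 5 *\<^sub>R DZ f"
  using frechet_derivative_D12[OF assms, of _ v]
  by (auto simp: fun_eq_iff deriv_along_def[of "\<lambda>_. v"] scaleR_fun_apply)
    (auto simp: deriv_along_def)

lemma deriv_along_commute:
  "smooth f \<Longrightarrow> deriv_along (\<lambda>_. u) (deriv_along (\<lambda>_. v) f) = deriv_along (\<lambda>_. v) (deriv_along (\<lambda>_. u) f)"
  unfolding deriv_along_def by (simp add: second_frechet_derivative_commute_real)

lemma D1_D2_commute:
  assumes "smooth f"
  shows "D2 (D1 f) = D1 (D2 f)"
proof
  fix p
  have s: "smooth (\<lambda>q. frechet_derivative f (at q) u)" for u using assms by auto
  have e: "frechet_derivative (\<lambda>q. frechet_derivative f (at q) (frame2 p)) (at p) (frame1 p)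
    = frechet_derivative (\<lambda>q. frechet_derivative f (at q) (frame1 p)) (at p) (frame2 p)"
    by (rule second_frechet_derivative_commute_real[OF assms])
  show "D2 (D1 f) p = D1 (D2 f) p"
    unfolding deriv_along_def[of frame2 "D1 f"] deriv_along_def[of frame1 "D2 f"]
      frechet_derivative_D12[OF assms] e
    by (simp add: frame_defs)
qed

text \<open>The Heisenberg relations: \<open>DZ\<close> is central, and the only noncommuting pairs
  are \<open>D4\<close>, \<open>D1\<close> and \<open>D3\<close>, \<open>D2\<close>. The coefficient
  -3 is the scaling of \<open>frame3\<close>.\<close>

lemma deriv_commutators:
  assumes "smooth f"
  shows "D4 (D1 f) = D1 (D4 f) + DZ f" "D3 (D1 f) = D1 (D3 f)" "DZ (D1 f) = D1 (DZ f)"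
    "D4 (D2 f) = D2 (D4 f)" "D3 (D2 f) = D2 (D3 f) + (- 3) *\<^sub>R DZ f" "DZ (D2 f) = D2 (DZ f)"
    "D4 (D3 f) = D3 (D4 f)" "DZ (D3 f) = D3 (DZ f)" "DZ (D4 f) = D4 (DZ f)"
  using assms deriv_along_const_D12[OF assms]
  by (simp_all add: deriv_along_commute[of f]) (simp_all add: frame_defs)

text \<open>The contact distribution is bracket generating: \<open>DZ\<close> is the commutator of
  \<open>D4\<close> and \<open>D1\<close>, so the four derivatives along it control the full
  derivative.\<close>

lemma constant_if_derivs_zero:
  assumes "smooth f" "D1 f = 0" "D2 f = 0" "D3 f = 0" "D4 f = 0"
  shows "f p = f 0"
proof -
  have Z: "DZ f = 0"
    using deriv_commutators(1)[OF assms(1)] assms(2,5) by (simp add: fun_eq_iff)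
  have "frechet_derivative f (at q) v = 0" for q v
  proof -
    note l = linear_frechet_derivative_smooth[OF assms(1), of q]
    have "frechet_derivative f (at q) v = v $ 1 * D1 f q + v $ 2 * D2 f q + (- v $ 5 / 3) * D3 f q
      + v $ 4 * D4 f q
      + omega0 q [v] * DZ f q"
      by (subst frame_expansion[symmetric, of v q])
        (simp only: linear_add[OF l] linear_cmul[OF l] deriv_along_def real_scaleR_def)
    then show ?thesis using assms Z by simp
  qed
  then have "(f has_derivative (\<lambda>v. 0)) (at q)" for q
    using smooth_imp_has_derivative[OF assms(1), of q] by (metis ext)
  then show ?thesis
    using has_derivative_zero_unique[of UNIV f p 0] by auto
qed

text \<open>The generating function of an infinitesimal symmetry: its Hessian along the frame is confined
  to the 4-dimensional space of \<open>D1 (D3 f)\<close>, \<open>D2 (D4 f)\<close>, \<open>D4 (D1 f)\<close> and \<open>DZ f\<close>.\<close>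

definition generating :: "(real^5 \<Rightarrow> real) \<Rightarrow> bool" where
  "generating f \<longleftrightarrow> smooth f \<and> D1 (D1 f) = 0 \<and> D1 (D2 f) = 0 \<and> D3 (D4 f) = 0 \<and> D4 (D4 f) = 0 \<and>
     D3 (D3 f) = (- 2) *\<^sub>R D2 (D4 f) \<and> D2 (D2 f) = (- 2) *\<^sub>R D1 (D3 f) \<and>
     D3 (D2 f) = (- 1) *\<^sub>R (D4 (D1 f) + DZ f)"

text \<open>The nested product is a Euclidean space of dimension 14, the number against which the
  fourteen fields are counted.\<close>

definition jet :: "(real^5 \<Rightarrow> real) \<Rightarrow>
    real \<times> (real \<times> real \<times> real \<times> real) \<times> (real \<times> real \<times> real \<times> real) \<times> (real \<times> real \<times> real \<times> real) \<times> real" where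
  "jet f = (f 0, (D1 f 0, D2 f 0, D3 f 0, D4 f 0), (D1 (D3 f) 0, D2 (D4 f) 0, D4 (D1 f) 0, DZ f 0),
     (D1 (DZ f) 0, D2 (DZ f) 0, D3 (DZ f) 0, D4 (DZ f) 0), DZ (DZ f) 0)"

text \<open>The 14 entries of the jet, as functions, form a closed first order system: the commutation
  relations of the frame turn the second order equations into formulas for all higher derivatives and
  force \<open>DZ (DZ f)\<close> to be constant.\<close>

lemma generating_jet_zero:
  assumes "generating f" and "jet f = 0"
  shows "f = 0"
proof -
  have sm [simp]: "smooth f"
    and pde: "D1 (D1 f) = 0" "D1 (D2 f) = 0" "D3 (D4 f) = 0" "D4 (D4 f) = 0"
     "D3 (D3 f) = (- 2) *\<^sub>R D2 (D4 f)" "D2 (D2 f) = (- 2) *\<^sub>R D1 (D3 f)"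
     "D3 (D2 f) = (- 1) *\<^sub>R (D4 (D1 f) + DZ f)"
    using assms(1) by (auto simp: generating_def)
  note comm = deriv_commutators D1_D2_commute
  define P where "P = D1 (D3 f)"
  define Q where "Q = D2 (D4 f)"
  define R where "R = D4 (D1 f)"
  define S where "S = DZ f"
  define W where "W = DZ S"
  have [simp]: "smooth P" "smooth Q" "smooth R" "smooth S" "smooth W"
    by (simp_all add: P_def Q_def R_def S_def W_def)
  \<comment> \<open>The whole Hessian along the frame in four unknown functions. Transposed entries
    for the pairs 1, 4 and 2, 3 differ by multiples of \<open>S\<close>, since these derivatives do
    not commute.\<close>
  have second:
    "D1 (D1 f) = 0" "D1 (D2 f) = 0" "D1 (D3 f) = P" "D1 (D4 f) = R - S"
    "D2 (D1 f) = 0" "D2 (D2 f) = (- 2) *\<^sub>R P" "D2 (D3 f) = 2 *\<^sub>R S - R" "D2 (D4 f) = Q"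
    "D3 (D1 f) = P" "D3 (D2 f) = (- 1) *\<^sub>R (R + S)" "D3 (D3 f) = (- 2) *\<^sub>R Q" "D3 (D4 f) = 0"
    "D4 (D1 f) = R" "D4 (D2 f) = Q" "D4 (D3 f) = 0" "D4 (D4 f) = 0"
    using pde comm[of f]
    by (simp_all add: P_def Q_def R_def S_def) (auto simp: fun_eq_iff scaleR_fun_apply algebra_simps)
  have DZ [simp]: "DZ (D1 g) = D1 (DZ g)" "DZ (D2 g) = D2 (DZ g)" "DZ (D3 g) = D3 (DZ g)"
    "DZ (D4 g) = D4 (DZ g)"
    if "smooth g" for g using that by (simp_all add: comm)
  have [simp]: "DZ f = S" "DZ S = W" by (simp_all add: S_def W_def)
  \<comment> \<open>Differentiating a first derivative of \<open>f\<close> in two orders gives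
    relations between the derivatives of \<open>P\<close>, \<open>Q\<close>, \<open>R\<close> and
    \<open>S\<close>; solved, they express everything through the four frame derivatives of
    \<open>S\<close>.\<close>
  have "D4 P = D3 S" "D1 P = 0" "D2 R = 0" "D3 R = D4 P" "D4 Q = 0"
    using comm(2,4,7)[of "D1 f"] comm(1)[of "D3 f"] comm(4)[of "D4 f"] by (simp_all add: second)
  moreover have "D1 Q p = - D2 S p" "D1 R p = - D1 S p" "D2 P p = 3 * D1 S p" "D2 Q p = - 2 * D4 P p"
    "D3 P p = - 2 * D1 Q p" "D3 Q p = - D4 R p - D4 S p" "D4 R p = 2 * D4 S p" for p
    using comm(1,5)[of "D1 f", THEN fun_cong, of p] comm(1,4,7)[of "D2 f", THEN fun_cong, of p]
      comm(2)[of "D3 f", THEN fun_cong, of p] comm(1)[of "D4 f", THEN fun_cong, of p]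
    by (simp_all add: second scaleR_fun_apply)
  ultimately have third:
    "D1 P = 0" "D1 Q = (- 1) *\<^sub>R D2 S" "D1 R = (- 1) *\<^sub>R D1 S"
    "D2 P = 3 *\<^sub>R D1 S" "D2 Q = (- 2) *\<^sub>R D4 P" "D2 R = 0"
    "D3 P = (- 2) *\<^sub>R D1 Q" "D3 Q = (- 1) *\<^sub>R (D4 R + D4 S)" "D3 R = D4 P"
    "D4 P = D3 S" "D4 Q = 0" "D4 R = 2 *\<^sub>R D4 S"
    by (auto intro!: ext simp: scaleR_fun_apply)
  \<comment> \<open>\<open>DZ\<close> commutes with the frame derivatives, so \<open>S\<close>
    satisfies the same system as \<open>f\<close>, with \<open>DZ P\<close>, \<open>DZ Q\<close>,
    \<open>DZ R\<close> and \<open>W\<close> in the role of \<open>P\<close>, \<open>Q\<close>,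
    \<open>R\<close> and \<open>S\<close>.\<close>
  have fourth:
    "D1 (D1 S) = 0" "D1 (D2 S) = 0" "D1 (D3 S) = DZ P" "D1 (D4 S) = DZ R - W"
    "D2 (D1 S) = 0" "D2 (D2 S) = (- 2) *\<^sub>R DZ P" "D2 (D3 S) = 2 *\<^sub>R W - DZ R" "D2 (D4 S) = DZ Q"
    "D3 (D1 S) = DZ P" "D3 (D2 S) = (- 1) *\<^sub>R (DZ R + W)" "D3 (D3 S) = (- 2) *\<^sub>R DZ Q" "D3 (D4 S) = 0"
    "D4 (D1 S) = DZ R" "D4 (D2 S) = DZ Q" "D4 (D3 S) = 0" "D4 (D4 S) = 0"
    using second[THEN arg_cong[where f=DZ]] by simp_all
  \<comment> \<open>The commutator of \<open>D4\<close> and \<open>D1\<close> on \<open>P\<close>,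
    \<open>Q\<close> and \<open>R\<close> closes the system: the outcomes are
    \<open>2 DZ P = 0\<close>, \<open>2 DZ Q = 0\<close> and \<open>4 DZ R = 2 W\<close>.\<close>
  have ZP: "DZ P = 0" using comm(1)[of P] by (simp add: third fourth fun_eq_iff)
  have ZQ: "DZ Q = 0" using comm(1)[of Q] by (simp add: third fourth fun_eq_iff scaleR_fun_apply)
  have ZR: "DZ R = (1/2) *\<^sub>R W"
  proof
    fix p
    show "DZ R p = ((1/2) *\<^sub>R W) p"
      using comm(1)[of R, THEN fun_cong, of p] by (simp add: third fourth scaleR_fun_apply)
  qed
  note fourth = fourth[unfolded ZP ZQ ZR]
  \<comment> \<open>One further round of commutators, now on derivatives of \<open>S\<close>,
    equates a nonzero multiple of each frame derivative of \<open>W\<close> with zero.\<close>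
  have "D1 W p = 0" "D2 W p = 0" "D3 W p = 0" "D4 W p = 0" for p
    using comm(1)[of "D1 S", THEN fun_cong, of p] comm(5)[of "D2 S", THEN fun_cong, of p]
      comm(5)[of "D3 S", THEN fun_cong, of p] comm(1)[of "D4 S", THEN fun_cong, of p]
    by (simp_all add: fourth scaleR_fun_apply)
  then have W: "D1 W = 0" "D2 W = 0" "D3 W = 0" "D4 W = 0" by auto
  have zero: "g = 0" if "smooth g" "D1 g = 0" "D2 g = 0" "D3 g = 0" "D4 g = 0" "g 0 = 0" for g
    using constant_if_derivs_zero[OF that(1-5)] that(6) by (simp add: fun_eq_iff)
  have at0: "f 0 = 0" "D1 f 0 = 0" "D2 f 0 = 0" "D3 f 0 = 0" "D4 f 0 = 0" "P 0 = 0" "Q 0 = 0"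
    "R 0 = 0" "S 0 = 0"
    "D1 S 0 = 0" "D2 S 0 = 0" "D3 S 0 = 0" "D4 S 0 = 0" "W 0 = 0"
    using assms(2) unfolding jet_def zero_prod_def P_def Q_def R_def W_def S_def prod.inject by blast+
  \<comment> \<open>The system is triangular: at each level, from \<open>W\<close> down to
    \<open>f\<close>, the frame derivatives are combinations of functions already known to vanish,
    and the initial value is an entry of the jet.\<close>
  have W0: "W = 0" by (rule zero) (simp_all add: W at0)
  have S1: "D1 S = 0" "D2 S = 0" "D3 S = 0" "D4 S = 0"
    by (rule zero, simp_all add: fourth at0 W0)+
  have "S = 0" "P = 0" "R = 0"
    by (rule zero, simp_all add: third at0 S1)+
  moreover have "Q = 0"
    by (rule zero) (simp_all add: third at0 S1)
  ultimately have D: "D1 f = 0" "D2 f = 0" "D3 f = 0" "D4 f = 0"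
    by (rule_tac zero, simp_all add: second at0)+
  show ?thesis
    by (rule zero) (simp_all add: D at0)
qed

section \<open>The vector fields and their brackets\<close>

lemma has_derivative_vector_5:
  fixes f1 :: "'a::real_normed_vector \<Rightarrow> real"
  assumes "(f1 has_derivative g1) (at p)" "(f2 has_derivative g2) (at p)"
    "(f3 has_derivative g3) (at p)"
    "(f4 has_derivative g4) (at p)" "(f5 has_derivative g5) (at p)"
  shows "((\<lambda>q. vector [f1 q, f2 q, f3 q, f4 q, f5 q] :: real^5) has_derivative
    (\<lambda>v. vector [g1 v, g2 v, g3 v, g4 v, g5 v])) (at p)"
proof -
  have "\<forall>i. ((\<lambda>q. (vector [f1 q, f2 q, f3 q, f4 q, f5 q] :: real^5) $ i) has_derivative
    (\<lambda>v. vector [g1 v, g2 v, g3 v, g4 v, g5 v] $ i)) (at p)"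
    using assms by (simp add: forall_5)
  then show ?thesis
    by (subst has_derivative_componentwise_within)
      (auto simp: Basis_vec_def inner_axis)
qed

lemmas X_defs = X1_def X2_def X3_def X4_def X5_def X6_def X7_def X8_def X9_def X10_def X11_def
  X12_def X13_def X14_def

lemma smooth_vector_5:
  assumes "smooth f1" "smooth f2" "smooth f3" "smooth f4" "smooth f5"
  shows "smooth (\<lambda>p. vector [f1 p, f2 p, f3 p, f4 p, f5 p] :: real^5)"
proof -
  have "\<forall>i. smooth (\<lambda>p. (vector [f1 p, f2 p, f3 p, f4 p, f5 p] :: real^5) $ i)"
    using assms by (simp add: forall_5)
  then show ?thesis by (intro smooth_vecI) blast
qed

lemma smooth_X [simp]:
  "smooth X1" "smooth X2" "smooth X3" "smooth X4" "smooth X5" "smooth X6" "smooth X7" "smooth X8"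
  "smooth X9" "smooth X10" "smooth X11" "smooth X12" "smooth X13" "smooth X14"
  unfolding X_defs coord_field_def by (auto intro!: smooth_vector_5)

lemmas has_derivative_nth [derivative_intros] =
  bounded_linear.has_derivative[OF bounded_linear_vec_nth]

lemma has_derivative_X1:
  "(X1 has_derivative (\<lambda>v. vector
    [p $ 3 * v $ 1 + 3 * (p $ 2)^2 * v $ 2 + p $ 1 * v $ 3,
     -1/9 * (p $ 5)^2 * v $ 1 + p $ 3 * v $ 2 - 4/3 * p $ 2 * p $ 5 * v $ 2 + p $ 2 * v $ 3 - 2/9 * p $ 1 * p $ 5 * v $ 5 - 2/3 * (p $ 2)^2 * v $ 5,
     -2/27 * (p $ 5)^3 * v $ 1 - 2/3 * p $ 2 * (p $ 5)^2 * v $ 2 + 2 * p $ 3 * v $ 3 - 2/9 * p $ 1 * (p $ 5)^2 * v $ 5 - 2/3 * (p $ 2)^2 * p $ 5 * v $ 5,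
     - v $ 1 * (p $ 4)^2 - v $ 2 * p $ 4 * p $ 5 + p $ 4 * v $ 3 + p $ 3 * v $ 4 - 2 * p $ 1 * p $ 4 * v $ 4 - v $ 4 * p $ 2 * p $ 5 - v $ 5 * p $ 2 * p $ 4 + 1/9 * (p $ 5)^2 * v $ 5,
     - v $ 1 * p $ 4 * p $ 5 - 6 * p $ 2 * p $ 4 * v $ 2 - 1/3 * (p $ 5)^2 * v $ 2 + p $ 5 * v $ 3 - v $ 4 * p $ 1 * p $ 5 - 3 * (p $ 2)^2 * v $ 4 + p $ 3 * v $ 5 - v $ 5 * p $ 1 * p $ 4 - 2/3 * p $ 2 * p $ 5 * v $ 5])) (at p)"
  unfolding X1_def coord_field_def
  by (rule has_derivative_vector_5; auto intro!: derivative_eq_intros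
      simp: fun_eq_iff field_simps power2_eq_square power3_eq_cube)

lemma has_derivative_X2:
  "(X2 has_derivative (\<lambda>v. vector
    [2 * p $ 1 * v $ 1,
     p $ 2 * v $ 1 + p $ 1 * v $ 2,
     p $ 3 * v $ 1 - 3 * (p $ 2)^2 * v $ 2 + p $ 1 * v $ 3,
     - v $ 1 * p $ 4 - v $ 2 * p $ 5 + v $ 3 - v $ 4 * p $ 1 - v $ 5 * p $ 2,
     -6 * p $ 2 * v $ 2])) (at p)"
  unfolding X2_def coord_field_def
  by (rule has_derivative_vector_5; auto intro!: derivative_eq_intros
      simp: fun_eq_iff field_simps power2_eq_square power3_eq_cube)

lemma has_derivative_X3:
  "(X3 has_derivative (\<lambda>v. vector
    [-1/2 * v $ 3,
     1/9 * p $ 5 * v $ 5,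
     1/9 * (p $ 5)^2 * v $ 5,
     p $ 4 * v $ 4,
     1/2 * p $ 5 * v $ 4 + 1/2 * p $ 4 * v $ 5])) (at p)"
  unfolding X3_def coord_field_def
  by (rule has_derivative_vector_5; auto intro!: derivative_eq_intros
      simp: fun_eq_iff field_simps power2_eq_square power3_eq_cube)

lemma has_derivative_X4:
  "(X4 has_derivative (\<lambda>v. vector
    [-6 * p $ 2 * v $ 2,
     4/3 * p $ 5 * v $ 2 - v $ 3 + 4/3 * p $ 2 * v $ 5,
     2/3 * (p $ 5)^2 * v $ 2 + 4/3 * p $ 2 * p $ 5 * v $ 5,
     p $ 5 * v $ 4 + p $ 4 * v $ 5,
     6 * p $ 4 * v $ 2 + 6 * p $ 2 * v $ 4 + 2/3 * p $ 5 * v $ 5])) (at p)"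
  unfolding X4_def coord_field_def
  by (rule has_derivative_vector_5; auto intro!: derivative_eq_intros
      simp: fun_eq_iff field_simps power2_eq_square power3_eq_cube)

lemma has_derivative_X5:
  "(X5 has_derivative (\<lambda>v. vector
    [0,
     1/3 * v $ 2,
     v $ 3,
     v $ 4,
     2/3 * v $ 5])) (at p)"
  unfolding X5_def coord_field_def
  by (rule has_derivative_vector_5; auto intro!: derivative_eq_intros
      simp: fun_eq_iff field_simps power2_eq_square power3_eq_cube)

lemma has_derivative_X6:
  "(X6 has_derivative (\<lambda>v. vector
    [9/2 * p $ 2 * v $ 1 + 9/2 * p $ 1 * v $ 2,
     - v $ 1 * p $ 5 + 3 * p $ 2 * v $ 2 - v $ 5 * p $ 1,
     -1/2 * (p $ 5)^2 * v $ 1 + 9/2 * p $ 3 * v $ 2 + 9/2 * p $ 2 * v $ 3 - v $ 5 * p $ 1 * p $ 5,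
     p $ 5 * v $ 5,
     -9/2 * p $ 4 * v $ 1 + 3/2 * p $ 5 * v $ 2 + 9/2 * v $ 3 - 9/2 * p $ 1 * v $ 4 + 3/2 * p $ 2 * v $ 5])) (at p)"
  unfolding X6_def coord_field_def
  by (rule has_derivative_vector_5; auto intro!: derivative_eq_intros
      simp: fun_eq_iff field_simps power2_eq_square power3_eq_cube)

lemma has_derivative_X7:
  "(X7 has_derivative (\<lambda>v. vector
    [0,
     - v $ 1,
     6 * p $ 2 * v $ 2,
     v $ 5,
     6 * v $ 2])) (at p)"
  unfolding X7_def coord_field_def
  by (rule has_derivative_vector_5; auto intro!: derivative_eq_intros
      simp: fun_eq_iff field_simps power2_eq_square power3_eq_cube)

lemma has_derivative_X8:
  "(X8 has_derivative (\<lambda>v. vector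
    [v $ 1,
     2/3 * v $ 2,
     v $ 3,
     0,
     1/3 * v $ 5])) (at p)"
  unfolding X8_def coord_field_def
  by (rule has_derivative_vector_5; auto intro!: derivative_eq_intros
      simp: fun_eq_iff field_simps power2_eq_square power3_eq_cube)

lemma has_derivative_X9:
  "(X9 has_derivative (\<lambda>v. vector
    [v $ 2,
     -2/9 * v $ 5,
     -2/9 * p $ 5 * v $ 5,
     0,
     - v $ 4])) (at p)"
  unfolding X9_def coord_field_def
  by (rule has_derivative_vector_5; auto intro!: derivative_eq_intros
      simp: fun_eq_iff field_simps power2_eq_square power3_eq_cube)

lemma has_derivative_X10:
  "(X10 has_derivative (\<lambda>v. vector
    [0,
     0,
     v $ 1,
     0,
     0])) (at p)"
  unfolding X10_def coord_field_def
  by (rule has_derivative_vector_5; auto intro!: derivative_eq_intros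
      simp: fun_eq_iff field_simps power2_eq_square power3_eq_cube)

lemma has_derivative_X11:
  "(X11 has_derivative (\<lambda>v. vector
    [0,
     0,
     v $ 2,
     0,
     0])) (at p)"
  unfolding X11_def coord_field_def
  by (rule has_derivative_vector_5; auto intro!: derivative_eq_intros
      simp: fun_eq_iff field_simps power2_eq_square power3_eq_cube)

lemma has_derivative_X12:
  "(X12 has_derivative (\<lambda>v. vector
    [0,
     0,
     0,
     0,
     0])) (at p)"
  unfolding X12_def coord_field_def
  by (rule has_derivative_vector_5; auto intro!: derivative_eq_intros
      simp: fun_eq_iff field_simps power2_eq_square power3_eq_cube)

lemma has_derivative_X13:
  "(X13 has_derivative (\<lambda>v. vector
    [0,
     0,
     0,
     0,
     0])) (at p)"
  unfolding X13_def coord_field_def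
  by (rule has_derivative_vector_5; auto intro!: derivative_eq_intros
      simp: fun_eq_iff field_simps power2_eq_square power3_eq_cube)

lemma has_derivative_X14:
  "(X14 has_derivative (\<lambda>v. vector
    [0,
     0,
     0,
     0,
     0])) (at p)"
  unfolding X14_def coord_field_def
  by (rule has_derivative_vector_5; auto intro!: derivative_eq_intros
      simp: fun_eq_iff field_simps power2_eq_square power3_eq_cube)

lemmas X_apply = X_defs[THEN fun_cong, unfolded coord_field_def]

lemmas frechet_derivative_X =
  has_derivative_X1[THEN frechet_derivative_eqI] has_derivative_X2[THEN frechet_derivative_eqI]
  has_derivative_X3[THEN frechet_derivative_eqI] has_derivative_X4[THEN frechet_derivative_eqI]
  has_derivative_X5[THEN frechet_derivative_eqI] has_derivative_X6[THEN frechet_derivative_eqI]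
  has_derivative_X7[THEN frechet_derivative_eqI] has_derivative_X8[THEN frechet_derivative_eqI]
  has_derivative_X9[THEN frechet_derivative_eqI] has_derivative_X10[THEN frechet_derivative_eqI]
  has_derivative_X11[THEN frechet_derivative_eqI] has_derivative_X12[THEN frechet_derivative_eqI]
  has_derivative_X13[THEN frechet_derivative_eqI] has_derivative_X14[THEN frechet_derivative_eqI]

lemma X_symmetry_equations:
  "symmetry_equations p (X1 p) (frechet_derivative X1 (at p))"
  "symmetry_equations p (X2 p) (frechet_derivative X2 (at p))"
  "symmetry_equations p (X3 p) (frechet_derivative X3 (at p))"
  "symmetry_equations p (X4 p) (frechet_derivative X4 (at p))"
  "symmetry_equations p (X5 p) (frechet_derivative X5 (at p))"
  "symmetry_equations p (X6 p) (frechet_derivative X6 (at p))"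
  "symmetry_equations p (X7 p) (frechet_derivative X7 (at p))"
  "symmetry_equations p (X8 p) (frechet_derivative X8 (at p))"
  "symmetry_equations p (X9 p) (frechet_derivative X9 (at p))"
  "symmetry_equations p (X10 p) (frechet_derivative X10 (at p))"
  "symmetry_equations p (X11 p) (frechet_derivative X11 (at p))"
  "symmetry_equations p (X12 p) (frechet_derivative X12 (at p))"
  "symmetry_equations p (X13 p) (frechet_derivative X13 (at p))"
  "symmetry_equations p (X14 p) (frechet_derivative X14 (at p))"
  by (simp_all add: symmetry_equations_def omega0_1 frechet_derivative_X frame_defs X_apply
      field_simps power2_eq_square power3_eq_cube)

section \<open>Structure constants of the fourteen fields\<close>

lemmas bracket_simps = fun_eq_iff vec_eq_iff forall_5 vf_bracket_def frechet_derivative_X scaleR_fun_apply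
  X_apply

lemma bracket_X1:
  shows "vf_bracket X1 X2 = 0"
    and "vf_bracket X1 X3 = 0"
    and "vf_bracket X1 X4 = 0"
    and "vf_bracket X1 X5 = - X1"
    and "vf_bracket X1 X6 = 0"
    and "vf_bracket X1 X7 = 0"
    and "vf_bracket X1 X8 = - X1"
    and "vf_bracket X1 X9 = 0"
    and "vf_bracket X1 X10 = - X2"
    and "vf_bracket X1 X11 = (-2/9) *\<^sub>R X6"
    and "vf_bracket X1 X12 = 2 *\<^sub>R X3"
    and "vf_bracket X1 X13 = X4"
    and "vf_bracket X1 X14 = - X5 - X8"
  by (simp_all add: bracket_simps field_simps power2_eq_square power3_eq_cube)

lemma bracket_X2:
  shows "vf_bracket X2 X3 = (1/2) *\<^sub>R X1"
    and "vf_bracket X2 X4 = 0"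
    and "vf_bracket X2 X5 = 0"
    and "vf_bracket X2 X6 = 0"
    and "vf_bracket X2 X7 = 0"
    and "vf_bracket X2 X8 = - X2"
    and "vf_bracket X2 X9 = (-2/9) *\<^sub>R X6"
    and "vf_bracket X2 X10 = 0"
    and "vf_bracket X2 X11 = 0"
    and "vf_bracket X2 X12 = X5 + (-2) *\<^sub>R X8"
    and "vf_bracket X2 X13 = X7"
    and "vf_bracket X2 X14 = - X10"
  by (simp_all add: bracket_simps field_simps power2_eq_square power3_eq_cube)

lemma bracket_X3:
  shows "vf_bracket X3 X4 = 0"
    and "vf_bracket X3 X5 = - X3"
    and "vf_bracket X3 X6 = 0"
    and "vf_bracket X3 X7 = (-1/2) *\<^sub>R X4"
    and "vf_bracket X3 X8 = 0"
    and "vf_bracket X3 X9 = 0"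
    and "vf_bracket X3 X10 = - X5 + (1/2) *\<^sub>R X8"
    and "vf_bracket X3 X11 = (1/2) *\<^sub>R X9"
    and "vf_bracket X3 X12 = 0"
    and "vf_bracket X3 X13 = 0"
    and "vf_bracket X3 X14 = (1/2) *\<^sub>R X12"
  by (simp_all add: bracket_simps field_simps power2_eq_square power3_eq_cube)

lemma bracket_X4:
  shows "vf_bracket X4 X5 = (-2/3) *\<^sub>R X4"
    and "vf_bracket X4 X6 = (-9/2) *\<^sub>R X1"
    and "vf_bracket X4 X7 = (-4/3) *\<^sub>R X6"
    and "vf_bracket X4 X8 = (-1/3) *\<^sub>R X4"
    and "vf_bracket X4 X9 = 2 *\<^sub>R X3"
    and "vf_bracket X4 X10 = - X7"
    and "vf_bracket X4 X11 = - X5"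
    and "vf_bracket X4 X12 = 0"
    and "vf_bracket X4 X13 = 6 *\<^sub>R X9"
    and "vf_bracket X4 X14 = X13"
  by (simp_all add: bracket_simps field_simps power2_eq_square power3_eq_cube)

lemma bracket_X5:
  shows "vf_bracket X5 X6 = (1/3) *\<^sub>R X6"
    and "vf_bracket X5 X7 = (-1/3) *\<^sub>R X7"
    and "vf_bracket X5 X8 = 0"
    and "vf_bracket X5 X9 = (1/3) *\<^sub>R X9"
    and "vf_bracket X5 X10 = - X10"
    and "vf_bracket X5 X11 = (-2/3) *\<^sub>R X11"
    and "vf_bracket X5 X12 = 0"
    and "vf_bracket X5 X13 = (-1/3) *\<^sub>R X13"
    and "vf_bracket X5 X14 = - X14"
  by (simp_all add: bracket_simps field_simps power2_eq_square power3_eq_cube)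

lemma bracket_X6:
  shows "vf_bracket X6 X7 = (9/2) *\<^sub>R X2"
    and "vf_bracket X6 X8 = (-2/3) *\<^sub>R X6"
    and "vf_bracket X6 X9 = X4"
    and "vf_bracket X6 X10 = 0"
    and "vf_bracket X6 X11 = - X7"
    and "vf_bracket X6 X12 = (-9/2) *\<^sub>R X9"
    and "vf_bracket X6 X13 = (-9/2) *\<^sub>R X8"
    and "vf_bracket X6 X14 = (-9/2) *\<^sub>R X11"
  by (simp_all add: bracket_simps field_simps power2_eq_square power3_eq_cube)

lemma bracket_X7:
  shows "vf_bracket X7 X8 = (-1/3) *\<^sub>R X7"
    and "vf_bracket X7 X9 = X5 - X8"
    and "vf_bracket X7 X10 = 0"
    and "vf_bracket X7 X11 = - X10"
    and "vf_bracket X7 X12 = X13"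
    and "vf_bracket X7 X13 = (-6) *\<^sub>R X11"
    and "vf_bracket X7 X14 = 0"
  by (simp_all add: bracket_simps field_simps power2_eq_square power3_eq_cube)

lemma bracket_X8:
  shows "vf_bracket X8 X9 = (-1/3) *\<^sub>R X9"
    and "vf_bracket X8 X10 = 0"
    and "vf_bracket X8 X11 = (-1/3) *\<^sub>R X11"
    and "vf_bracket X8 X12 = - X12"
    and "vf_bracket X8 X13 = (-2/3) *\<^sub>R X13"
    and "vf_bracket X8 X14 = - X14"
  by (simp_all add: bracket_simps field_simps power2_eq_square power3_eq_cube)

lemma bracket_X9:
  shows "vf_bracket X9 X10 = X11"
    and "vf_bracket X9 X11 = (2/9) *\<^sub>R X13"
    and "vf_bracket X9 X12 = 0"
    and "vf_bracket X9 X13 = - X12"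
    and "vf_bracket X9 X14 = 0"
  by (simp_all add: bracket_simps field_simps power2_eq_square power3_eq_cube)

lemma bracket_X10:
  shows "vf_bracket X10 X11 = 0"
    and "vf_bracket X10 X12 = - X14"
    and "vf_bracket X10 X13 = 0"
    and "vf_bracket X10 X14 = 0"
  by (simp_all add: bracket_simps field_simps power2_eq_square power3_eq_cube)

lemma bracket_X11:
  shows "vf_bracket X11 X12 = 0"
    and "vf_bracket X11 X13 = - X14"
    and "vf_bracket X11 X14 = 0"
  by (simp_all add: bracket_simps field_simps power2_eq_square power3_eq_cube)

lemma bracket_X12:
  shows "vf_bracket X12 X13 = 0"
    and "vf_bracket X12 X14 = 0"
  by (simp_all add: bracket_simps field_simps power2_eq_square power3_eq_cube)

lemma bracket_X13:
  shows "vf_bracket X13 X14 = 0"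
  by (simp_all add: bracket_simps field_simps power2_eq_square power3_eq_cube)

section \<open>The space of symmetries\<close>

text \<open>The four contact equations say that the frame derivatives of \<open>f\<close> are, up to
  constants, the components 4, 5, 2 and 1 of \<open>X\<close>; with \<open>f\<close> itself they
  recover component 3. The \<gg>\<ll>(2) equations on the derivative of \<open>X\<close> thus become
  second order equations for \<open>f\<close>.\<close>

lemma generating_of_symmetry:
  fixes X :: "real^5 \<Rightarrow> real^5"
  assumes sm: "smooth X" and eq: "\<And>p. symmetry_equations p (X p) (frechet_derivative X (at p))"
  defines "f \<equiv> \<lambda>p. omega0 p [X p]"
  shows "generating f"
    and "X p = vector [- D4 f p, D3 f p / 3, f p - p $ 4 * D4 f p + p $ 5 * D3 f p / 3, D1 f p, D2 f p]"
proof -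
  let ?D = "\<lambda>p. frechet_derivative X (at p)"
  have f: "f = (\<lambda>p. X p $ 3 - p $ 4 * X p $ 1 - p $ 5 * X p $ 2)"
    by (auto simp: f_def omega0_1)
  have smf: "smooth f" unfolding f using sm by auto
  have comp: "frechet_derivative (\<lambda>q. X q $ i) (at p) v = ?D p v $ i" for p v i
    by (rule frechet_derivative_bounded_linear_comp[OF bounded_linear_vec_nth sm])
  have "(f has_derivative (\<lambda>v. omega0 p [?D p v] - v $ 4 * X p $ 1 - v $ 5 * X p $ 2)) (at p)" for p
    unfolding f
    by (auto intro!: derivative_eq_intros smooth_imp_has_derivative[OF sm] simp: omega0_1)
  note H = this
  have df: "frechet_derivative f (at p) v = omega0 p [?D p v] - v $ 4 * X p $ 1 - v $ 5 * X p $ 2"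
    for p v
    by (simp add: H[THEN frechet_derivative_eqI])
  note eq = eq[unfolded symmetry_equations_def]
  have D: "D1 f p = X p $ 4" "D2 f p = X p $ 5" "D3 f p = 3 * X p $ 2" "D4 f p = - X p $ 1" for p
    using eq[of p] by (simp_all add: deriv_along_def df, simp_all add: frame_defs)
  then show "X p = vector [- D4 f p, D3 f p / 3, f p - p $ 4 * D4 f p
    + p $ 5 * D3 f p / 3, D1 f p, D2 f p]"
    by (simp add: vec_eq_iff forall_5) (simp add: f)
  have fn: "D1 f = (\<lambda>p. X p $ 4)" "D2 f = (\<lambda>p. X p $ 5)" "D3 f = 3 *\<^sub>R (\<lambda>p. X p $ 2)"
      "D4 f = (- 1) *\<^sub>R (\<lambda>p. X p $ 1)"
    by (simp_all add: fun_eq_iff D scaleR_fun_apply)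
  have smc: "smooth (\<lambda>p. X p $ i)" for i using sm by auto
  have dc: "deriv_along V (\<lambda>p. X p $ i) p = ?D p (V p) $ i" for V p i
    by (simp add: deriv_along_def comp)
  show "generating f"
    unfolding generating_def
  proof (intro conjI ext smf)
    fix p
    \<comment> \<open>The pointwise equations do not mention the derivative along
      \<open>reeb\<close>, so \<open>DZ f\<close> is expressed as a commutator.\<close>
    have "D4 (D1 f) p = D1 (D4 f) p + DZ f p"
      using deriv_commutators(1)[OF smf, THEN fun_cong] by simp
    then show "D1 (D1 f) p = 0 p" "D1 (D2 f) p = 0 p" "D3 (D4 f) p = 0 p" "D4 (D4 f) p = 0 p"
      "D3 (D3 f) p = ((- 2) *\<^sub>R D2 (D4 f)) p" "D2 (D2 f) p = ((- 2) *\<^sub>R D1 (D3 f)) p"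
      "D3 (D2 f) p = ((- 1) *\<^sub>R (D4 (D1 f) + DZ f)) p"
      using eq[of p] by (simp_all add: fn smc scaleR_fun_apply dc)
  qed
qed

lemma jet_add: "generating f \<Longrightarrow> generating g \<Longrightarrow> jet (f + g) = jet f + jet g"
  by (simp add: jet_def generating_def)

lemma jet_scaleR: "generating f \<Longrightarrow> jet (c *\<^sub>R f) = c *\<^sub>R jet f"
  by (simp add: jet_def generating_def scaleR_fun_apply)

text \<open>By dimension, \<open>T\<close> already maps \<open>span B\<close> onto the whole target,
  so any \<open>x\<close> in \<open>S\<close> shares its value with some \<open>y\<close> in
  \<open>span B\<close>, and injectivity gives \<open>x = y\<close>. As \<open>T\<close> is linear
  on \<open>S\<close> only, the dimension argument runs through a linear \<open>g\<close> that
  agrees with it on \<open>span B\<close>.\<close>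

lemma span_eq_of_injective:
  fixes T :: "'a::real_vector \<Rightarrow> 'b::euclidean_space"
  assumes S: "subspace S"
    and add: "\<And>x y. x \<in> S \<Longrightarrow> y \<in> S \<Longrightarrow> T (x + y) = T x + T y"
    and scale: "\<And>c x. x \<in> S \<Longrightarrow> T (c *\<^sub>R x) = c *\<^sub>R T x"
    and inj: "\<And>x. x \<in> S \<Longrightarrow> T x = 0 \<Longrightarrow> x = 0"
    and B: "B \<subseteq> S" "independent B" "card B = DIM('b)"
  shows "span B = S"
proof
  show "span B \<subseteq> S" using B(1) S by (rule span_minimal)
  then have BS: "\<And>x. x \<in> span B \<Longrightarrow> x \<in> S" by blast
  obtain g where g: "linear g" "\<And>b. b \<in> B \<Longrightarrow> g b = T b"
    using linear_independent_extend[OF B(2), of T] by blast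
  have "x \<in> S \<and> g x = T x" if "x \<in> span B" for x
    using that
  proof (induction rule: span_induct_alt)
    case base
    show ?case using scale[of 0 0] S by (simp add: linear_0[OF g(1)] subspace_0)
  next
    case (step c x y)
    then have "x \<in> S" "c *\<^sub>R x \<in> S" "y \<in> S" using B(1) S by (auto intro: subspace_scale)
    then show ?case using step g add scale S
      by (simp add: linear_add[OF g(1)] linear_cmul[OF g(1)] subspace_add)
  qed
  then have gT: "\<And>x. x \<in> span B \<Longrightarrow> g x = T x" by blast
  have "inj_on g (span B)"
    unfolding linear_inj_on_iff_eq_0[OF g(1) subspace_span]
    using gT BS inj by metis
  then have ind: "independent (g ` B)" "card (g ` B) = DIM('b)"
    using linear_independent_injective_image[OF g(1) B(2)] B(3) card_image inj_on_subset span_superset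
    by metis+
  then have "UNIV \<subseteq> span (g ` B)"
    by (intro card_ge_dim_independent) auto
  then have "y \<in> g ` span B" for y
    unfolding linear_span_image[OF g(1)] by blast
  then have onto: "\<exists>x\<in>span B. g x = y" for y
    by (metis imageE)
  show "S \<subseteq> span B"
  proof
    fix x assume x: "x \<in> S"
    obtain y where y: "y \<in> span B" "g y = T x" using onto by blast
    have "T (x + (- 1) *\<^sub>R y) = T x + (- 1) *\<^sub>R T y"
      using x y BS S by (simp only: add scale subspace_scale)
    also have "\<dots> = 0" using y gT by simp
    finally have "x + (- 1) *\<^sub>R y = 0"
      using inj x y BS S by (metis subspace_add subspace_scale)
    then show "x \<in> span B" using y by simp
  qed
qed

lemma omega0_linear: "omega0 p [v + w] = omega0 p [v] + omega0 p [w]"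
  "omega0 p [c *\<^sub>R v] = c * omega0 p [v]"
  by (simp_all add: omega0_1 algebra_simps)

lemma symmetry_equations_add:
  "symmetry_equations p w D \<Longrightarrow> symmetry_equations p w' D'
    \<Longrightarrow> symmetry_equations p (w + w') (\<lambda>v. D v + D' v)"
  by (simp add: symmetry_equations_def omega0_linear distrib_left)

lemma symmetry_equations_scaleR:
  "symmetry_equations p w D \<Longrightarrow> symmetry_equations p (c *\<^sub>R w) (\<lambda>v. c *\<^sub>R D v)"
proof -
  assume eq: "symmetry_equations p w D"
  then have "D frame3 $ 5 = - (2 * D frame4 $ 4 + D (frame1 p) $ 1)"
    "D (frame2 p) $ 2 = (D frame4 $ 4 + 2 * D (frame1 p) $ 1) / 3"
      "D frame3 $ 2 = 2 / 3 * D (frame2 p) $ 1"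
    by (simp_all add: symmetry_equations_def)
  with eq show ?thesis
    by (simp add: symmetry_equations_def omega0_linear) (simp add: algebra_simps)
qed

lemma subspace_symmetries: "subspace (infinitesimal_symmetries omega0 Upsilon)"
proof (rule subspaceI)
  have "symmetry_equations p ((0 :: real^5 \<Rightarrow> real^5) p) (frechet_derivative 0 (at p))" for p
    unfolding zero_fun_def by (simp add: frechet_derivative_const symmetry_equations_def omega0_1)
  then show "0 \<in> infinitesimal_symmetries omega0 Upsilon"
    by (simp add: symmetries_iff)
next
  fix X Y assume XY: "X \<in> infinitesimal_symmetries omega0 Upsilon"
    "Y \<in> infinitesimal_symmetries omega0 Upsilon"
  then have "frechet_derivative (X + Y) (at p)
    = (\<lambda>v. frechet_derivative X (at p) v + frechet_derivative Y (at p) v)" for p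
    by (auto simp: symmetries_iff frechet_derivative_add_fun)
  with XY show "X + Y \<in> infinitesimal_symmetries omega0 Upsilon"
    by (simp add: symmetries_iff symmetry_equations_add)
next
  fix X and c :: real assume X: "X \<in> infinitesimal_symmetries omega0 Upsilon"
  then have "frechet_derivative (c *\<^sub>R X) (at p) = (\<lambda>v. c *\<^sub>R frechet_derivative X (at p) v)" for p
    by (auto simp: symmetries_iff frechet_derivative_scaleR_fun)
  with X show "c *\<^sub>R X \<in> infinitesimal_symmetries omega0 Upsilon"
    by (simp add: symmetries_iff scaleR_fun_apply symmetry_equations_scaleR)
qed

section \<open>Independence of the fourteen fields\<close>

definition X_list :: "(real^5 \<Rightarrow> real^5) list" where
  "X_list = [X1, X2, X3, X4, X5, X6, X7, X8, X9, X10, X11, X12, X13, X14]"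

lemma X_list_nth:
  "X_list ! 0 = X1" "X_list ! Suc 0 = X2" "X_list ! 2 = X3" "X_list ! 3 = X4" "X_list ! 4 = X5"
    "X_list ! 5 = X6"
  "X_list ! 6 = X7" "X_list ! 7 = X8" "X_list ! 8 = X9" "X_list ! 9 = X10" "X_list ! 10 = X11"
  "X_list ! 11 = X12" "X_list ! 12 = X13" "X_list ! 13 = X14"
  by (simp_all add: X_list_def)

lemma sum_14: "(\<Sum>i<14::nat. f i) =
  f 0 + f 1 + f 2 + f 3 + f 4 + f 5 + f 6 + f 7 + f 8 + f 9 + f 10 + f 11 + f 12 + (f 13 :: 'a::comm_monoid_add)"
  by (simp add: lessThan_Suc numeral_eq_Suc ac_simps)

lemma X_list_lincomb_eq_0:
  assumes "(\<Sum>i<14. c i *\<^sub>R X_list ! i) = 0" "i < 14"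
  shows "c i = 0"
proof -
  have "(\<Sum>i<14. c i *\<^sub>R X_list ! i) p $ k = 0" for p k
    unfolding assms(1) by simp
  then have e: "(c 0 *\<^sub>R X1 + c 1 *\<^sub>R X2 + c 2 *\<^sub>R X3 + c 3 *\<^sub>R X4 + c 4 *\<^sub>R X5 + c 5 *\<^sub>R X6
    + c 6 *\<^sub>R X7
     + c 7 *\<^sub>R X8 + c 8 *\<^sub>R X9 + c 9 *\<^sub>R X10 + c 10 *\<^sub>R X11 + c 11 *\<^sub>R X12 + c 12 *\<^sub>R X13 + c 13 *\<^sub>R X14) p $ k = 0" for p k
    unfolding sum_14 by (simp add: X_list_nth)
  note e = e[unfolded plus_fun_apply scaleR_fun_apply X_apply vector_add_component vector_scaleR_component]
  \<comment> \<open>At the origin only the five fields of negative degree survive, each in its own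
    component.\<close>
  have "c 11 = 0" "c 12 = 0" "c 13 = 0" "c 9 = 0" "c 10 = 0"
    using e[of 0 1] e[of 0 2] e[of 0 3] e[of 0 4] e[of 0 5] by simp_all
  moreover have "c 2 = 0" "c 3 = 0" "c 1 = 0" "c 5 = 0"
    using e[of "vector [0,0,1,0,0]" 1] e[of "vector [0,0,1,0,0]" 2] e[of "vector [0,0,1,0,0]" 4]
      e[of "vector [0,0,1,0,0]" 5] calculation by simp_all
  \<comment> \<open>In the third component \<open>X1\<close> contributes the square of z, while
    \<open>X5\<close> and \<open>X8\<close> contribute z; the points z = 1 and z = -1 separate even
    from odd.\<close>
  moreover have "c 0 = 0 \<and> c 4 + c 7 = 0"
    using e[of "vector [0,0,1,0,0]" 3] e[of "vector [0,0,-1,0,0]" 3] calculation by simp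
  moreover have "c 7 = 0" "c 6 = 0"
    using e[of "vector [1,0,0,0,0]" 1] e[of "vector [1,0,0,0,0]" 2] calculation by simp_all
  moreover have "c 8 = 0"
    using e[of "vector [0,1,0,0,0]" 1] calculation by simp
  moreover have "i \<in> {0,1,2,3,4,5,6,7,8,9,10,11,12,13}"
    using assms(2) by simp presburger
  ultimately show ?thesis by auto
qed

text \<open>Indexing by position lets coefficients be compared without knowing that the fourteen
  fields differ; a repeated entry would give the nontrivial relation with coefficients 1 and
  -1.\<close>

lemma independent_nth_list:
  fixes xs :: "'a::real_vector list"
  assumes "\<And>c. (\<Sum>i<length xs. c i *\<^sub>R xs ! i) = 0 \<Longrightarrow> (\<forall>i<length xs. c i = 0)"
  shows "distinct xs" and "independent (set xs)"
proof -
  show d: "distinct xs"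
    unfolding distinct_conv_nth
  proof (intro allI impI notI)
    fix i j assume ij: "i < length xs" "j < length xs" "i \<noteq> j" "xs ! i = xs ! j"
    let ?c = "\<lambda>k. (if k = i then 1 else 0) + (if k = j then - 1 else 0 :: real)"
    have "(\<Sum>k<length xs. ?c k *\<^sub>R xs ! k)
       = (\<Sum>k<length xs. (if k = i then xs ! i else 0)) + (\<Sum>k<length xs. (if k = j then - xs ! j else 0))"
      unfolding sum.distrib[symmetric] by (intro sum.cong) auto
    also have "\<dots> = 0" using ij by simp
    finally have "\<forall>k<length xs. ?c k = 0" by (rule assms)
    then show False using ij(1,3) by (auto dest!: spec[of _ i])
  qed
  have b: "bij_betw (\<lambda>i. xs ! i) {..<length xs} (set xs)"
    using d by (rule bij_betw_nth) auto
  show "independent (set xs)"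
    unfolding independent_explicit_module
  proof (intro allI impI)
    fix t u v assume t: "finite t" "t \<subseteq> set xs" "(\<Sum>v\<in>t. u v *\<^sub>R v) = 0" "v \<in> t"
    have "(\<Sum>i<length xs. (if xs ! i \<in> t then u (xs ! i) else 0) *\<^sub>R xs ! i)
      = (\<Sum>v\<in>set xs. (if v \<in> t then u v else 0) *\<^sub>R v)"
      by (rule sum.reindex_bij_betw[OF b])
    also have "\<dots> = (\<Sum>v\<in>t. u v *\<^sub>R v)"
      using t by (intro sum.mono_neutral_cong_right) auto
    finally have "\<forall>i<length xs. (if xs ! i \<in> t then u (xs ! i) else 0) = 0"
      using t(3) by (intro assms) simp
    moreover obtain i where "i < length xs" "xs ! i = v" using t by (metis in_mono in_set_conv_nth)
    ultimately show "u v = 0" using t(4) by auto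
  qed
qed

lemma length_X_list: "length X_list = 14"
  by (simp add: X_list_def)

lemma set_X_list: "set X_list = {X1, X2, X3, X4, X5, X6, X7, X8, X9, X10, X11, X12, X13, X14}"
  by (simp add: X_list_def)

theorem symmetries_eq_span: "infinitesimal_symmetries omega0 Upsilon = span (set X_list)"
proof -
  let ?S = "infinitesimal_symmetries omega0 Upsilon"
  let ?T = "\<lambda>X. jet (\<lambda>p. omega0 p [X p])"
  have gen: "generating (\<lambda>p. omega0 p [X p])" if "X \<in> ?S" for X
    using that by (auto simp: symmetries_iff intro: generating_of_symmetry(1))
  have add: "(\<lambda>p. omega0 p [(X + Y) p]) = (\<lambda>p. omega0 p [X p]) + (\<lambda>p. omega0 p [Y p])" for X Y
    by (auto simp: fun_eq_iff omega0_1 algebra_simps)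
  have scale: "(\<lambda>p. omega0 p [(c *\<^sub>R X) p]) = c *\<^sub>R (\<lambda>p. omega0 p [X p])" for c X
    by (auto simp: fun_eq_iff omega0_1 algebra_simps scaleR_fun_apply)
  have "distinct X_list" and ind: "independent (set X_list)"
    using independent_nth_list[of X_list] X_list_lincomb_eq_0 unfolding length_X_list by blast+
  then have card: "card (set X_list) = 14" by (simp add: distinct_card length_X_list)
  have "span (set X_list) = ?S"
  proof (rule span_eq_of_injective[of ?S ?T])
    show "subspace ?S" by (rule subspace_symmetries)
    show "?T (X + Y) = ?T X + ?T Y" if "X \<in> ?S" "Y \<in> ?S" for X Y
      unfolding add using that by (intro jet_add gen)
    show "?T (c *\<^sub>R X) = c *\<^sub>R ?T X" if "X \<in> ?S" for c X
      unfolding scale using that by (intro jet_scaleR gen)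
    \<comment> \<open>A symmetry is recovered from its generating function, so injectivity of the
      jet carries over to fields.\<close>
    show "X = 0" if X: "X \<in> ?S" and "?T X = 0" for X
    proof
      fix p
      have f: "(\<lambda>p. omega0 p [X p]) = 0" using gen[OF X] that(2) by (rule generating_jet_zero)
      show "X p = 0 p"
        using X fun_cong[OF f, of p] unfolding symmetries_iff
        by (subst generating_of_symmetry(2)[of X p]) (auto simp: f vec_eq_iff forall_5)
    qed
    show "set X_list \<subseteq> ?S"
      unfolding set_X_list by (auto simp: symmetries_iff X_symmetry_equations)
    show "independent (set X_list)" by (rule ind)
    show "card (set X_list) = DIM(real \<times> (real \<times> real \<times> real \<times> real) \<times> (real \<times> real \<times> real \<times> real)
      \<times> (real \<times> real \<times> real \<times> real) \<times> real)"
      by (simp add: card)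
  qed
  then show ?thesis by simp
qed

section \<open>The bracket on smooth vector fields\<close>

lemma vf_bracket_add:
  assumes "smooth X" "smooth Y" "smooth Z"
  shows "vf_bracket (X + Y) Z = vf_bracket X Z + vf_bracket Y Z"
    and "vf_bracket X (Y + Z) = vf_bracket X Y + vf_bracket X Z"
  using assms
  by (auto simp: vf_bracket_def fun_eq_iff frechet_derivative_add_fun
    linear_add[OF linear_frechet_derivative_smooth])

lemma vf_bracket_scaleR:
  assumes "smooth X" "smooth Y"
  shows "vf_bracket (c *\<^sub>R X) Y = c *\<^sub>R vf_bracket X Y"
    and "vf_bracket X (c *\<^sub>R Y) = c *\<^sub>R vf_bracket X Y"
  using assms
  by (auto simp: vf_bracket_def fun_eq_iff frechet_derivative_scaleR_fun scaleR_fun_apply scaleR_diff_right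
      linear_cmul[OF linear_frechet_derivative_smooth])

lemma vf_bracket_antisym: "vf_bracket Y X = - vf_bracket X Y"
  by (auto simp: vf_bracket_def)

lemma vf_bracket_self: "vf_bracket X X = 0"
  by (auto simp: vf_bracket_def)

text \<open>Base point and direction both vary with \<open>q\<close>. Expanding the direction in
  \<open>Basis\<close> gives a finite sum of scalar functions times derivatives in fixed directions,
  to which the product rule applies.\<close>

lemma has_derivative_frechet_along:
  fixes Y :: "'a::euclidean_space \<Rightarrow> 'a" and Z :: "'a \<Rightarrow> 'b::euclidean_space"
  assumes "smooth Y" "smooth Z"
  shows "((\<lambda>q. frechet_derivative Z (at q) (Y q)) has_derivative
    (\<lambda>v. frechet_derivative (\<lambda>q. frechet_derivative Z (at q) (Y p)) (at p) v
        + frechet_derivative Z (at p) (frechet_derivative Y (at p) v))) (at p)"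
proof -
  have lin: "linear (frechet_derivative Z (at q))" for q
    using assms(2) by (rule linear_frechet_derivative_smooth)
  have expand: "frechet_derivative Z (at q) w
    = (\<Sum>b\<in>Basis. (w \<bullet> b) *\<^sub>R frechet_derivative Z (at q) b)" for q w
    by (subst (1) euclidean_representation[symmetric, of w]) (simp only: linear_sum[OF lin]
      linear_cmul[OF lin])
  have d: "((\<lambda>q. frechet_derivative Z (at q) b) has_derivative
     frechet_derivative (\<lambda>q. frechet_derivative Z (at q) b) (at p)) (at p)" for b
    using assms by (intro smooth_imp_has_derivative) auto
  have "((\<lambda>q. \<Sum>b\<in>Basis. (Y p \<bullet> b) *\<^sub>R frechet_derivative Z (at q) b) has_derivative
     (\<lambda>v. \<Sum>b\<in>Basis. (Y p \<bullet> b) *\<^sub>R frechet_derivative (\<lambda>q. frechet_derivative Z (at q) b) (at p) v)) (at p)"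
    by (intro derivative_intros d)
  from frechet_derivative_eqI[OF this, folded expand]
  have const: "frechet_derivative (\<lambda>q. frechet_derivative Z (at q) (Y p)) (at p) v
     = (\<Sum>b\<in>Basis. (Y p \<bullet> b) *\<^sub>R frechet_derivative (\<lambda>q. frechet_derivative Z (at q) b) (at p) v)" for v
    by simp
  have "((\<lambda>q. \<Sum>b\<in>Basis. (Y q \<bullet> b) *\<^sub>R frechet_derivative Z (at q) b) has_derivative
     (\<lambda>v. \<Sum>b\<in>Basis. (Y p \<bullet> b) *\<^sub>R frechet_derivative (\<lambda>q. frechet_derivative Z (at q) b) (at p) v
        + (frechet_derivative Y (at p) v \<bullet> b) *\<^sub>R frechet_derivative Z (at p) b)) (at p)"
    by (intro has_derivative_sum has_derivative_scaleR has_derivative_inner_left smooth_imp_has_derivative assms d)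
  then show ?thesis
    unfolding expand[symmetric] sum.distrib const[symmetric] .
qed

text \<open>Second derivatives of each field occur twice, with opposite signs and interchanged
  directions, and cancel by symmetry. The compositions of first derivatives cancel in pairs.\<close>

lemma vf_bracket_jacobi:
  assumes "smooth X" "smooth Y" "smooth Z"
  shows "vf_bracket X (vf_bracket Y Z) + vf_bracket Y (vf_bracket Z X)
    + vf_bracket Z (vf_bracket X Y) = 0"
proof -
  have D: "frechet_derivative (vf_bracket Y Z) (at p) v =
     frechet_derivative (\<lambda>q. frechet_derivative Z (at q) (Y p)) (at p) v
        + frechet_derivative Z (at p) (frechet_derivative Y (at p) v)
   - (frechet_derivative (\<lambda>q. frechet_derivative Y (at q) (Z p)) (at p) v
        + frechet_derivative Y (at p) (frechet_derivative Z (at p) v))"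
    if "smooth Y" "smooth Z" for Y Z :: "'a \<Rightarrow> 'a" and p v
    unfolding vf_bracket_def
    by (simp add: frechet_derivative_eqI[OF has_derivative_diff[OF has_derivative_frechet_along[OF that]
        has_derivative_frechet_along[OF that(2,1)]]])
  show ?thesis
  proof
    fix p
    note c = second_frechet_derivative_commute[OF assms(1), of "Y p" p "Z p"]
      second_frechet_derivative_commute[OF assms(2), of "Z p" p "X p"]
      second_frechet_derivative_commute[OF assms(3), of "X p" p "Y p"]
    have l: "linear (frechet_derivative X (at p))" "linear (frechet_derivative Y (at p))"
      "linear (frechet_derivative Z (at p))"
      using assms by (auto intro: linear_frechet_derivative_smooth)
    show "(vf_bracket X (vf_bracket Y Z) + vf_bracket Y (vf_bracket Z X)
      + vf_bracket Z (vf_bracket X Y)) p = 0 p"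
      unfolding plus_fun_apply vf_bracket_def[of _ "vf_bracket _ _"]
      using assms c
      by (simp add: D) (simp add: vf_bracket_def linear_diff[OF l(1)] linear_diff[OF l(2)]
        linear_diff[OF l(3)])
  qed
qed

lemma vf_bracket_swap: "vf_bracket X Y = Z \<Longrightarrow> vf_bracket Y X = - Z"
  using vf_bracket_antisym by metis

lemmas bracket_upper = bracket_X1 bracket_X2 bracket_X3 bracket_X4 bracket_X5 bracket_X6 bracket_X7
  bracket_X8 bracket_X9 bracket_X10 bracket_X11 bracket_X12 bracket_X13

lemmas bracket_table = bracket_upper bracket_upper[THEN vf_bracket_swap] vf_bracket_self

lemma smooth_sum_fun: "(\<And>i. i \<in> A \<Longrightarrow> smooth (f i)) \<Longrightarrow> smooth (sum f A)"
  by (induction A rule: infinite_finite_induct) auto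

lemma vf_bracket_sum_right:
  assumes "smooth X" "\<And>i. i \<in> A \<Longrightarrow> smooth (Y i)"
  shows "vf_bracket X (\<Sum>i\<in>A. Y i) = (\<Sum>i\<in>A. vf_bracket X (Y i))"
  using assms(2)
proof (induction A rule: infinite_finite_induct)
  case (insert i A)
  then have "smooth (sum Y A)"
    by (intro smooth_sum_fun) auto
  with insert show ?case using assms(1) by (simp add: vf_bracket_add del: plus_fun_apply)
next
  case empty
  have "vf_bracket X (0 *\<^sub>R X) = 0 *\<^sub>R vf_bracket X X"
    using assms(1) by (rule vf_bracket_scaleR(2)[OF _ assms(1)])
  then show ?case by (simp del: zero_fun_apply)
next
  case (infinite A)
  have "vf_bracket X (0 *\<^sub>R X) = 0 *\<^sub>R vf_bracket X X"
    using assms(1) by (rule vf_bracket_scaleR(2)[OF _ assms(1)])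
  with infinite show ?case by (simp del: zero_fun_apply)
qed

lemma lie_algebra_vector_fields:
  assumes "subspace S" "\<And>X. X \<in> S \<Longrightarrow> smooth X" "\<And>X Y. X \<in> S \<Longrightarrow> Y \<in> S \<Longrightarrow> vf_bracket X Y \<in> S"
  shows "lie_algebra S vf_bracket"
  unfolding lie_algebra_def using assms
  by (simp add: vf_bracket_add vf_bracket_scaleR vf_bracket_self vf_bracket_jacobi)

abbreviation g2 :: "(real^5 \<Rightarrow> real^5) set" where "g2 \<equiv> span (set X_list)"

lemma X_list_smooth: "X \<in> set X_list \<Longrightarrow> smooth X"
  by (auto simp: set_X_list)

lemma g2_smooth: "X \<in> g2 \<Longrightarrow> smooth X"
  by (induction rule: span_induct_alt) (auto simp: X_list_smooth)

lemma X_list_in_g2: "X \<in> set X_list \<Longrightarrow> X \<in> g2"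
  by (rule span_base)

lemma X_in_g2 [simp]:
  "X1 \<in> g2" "X2 \<in> g2" "X3 \<in> g2" "X4 \<in> g2" "X5 \<in> g2" "X6 \<in> g2" "X7 \<in> g2" "X8 \<in> g2" "X9 \<in> g2"
  "X10 \<in> g2" "X11 \<in> g2" "X12 \<in> g2" "X13 \<in> g2" "X14 \<in> g2"
  by (rule span_base, simp add: set_X_list)+

lemma bracket_basis_in_g2:
  assumes "X \<in> set X_list" "Y \<in> set X_list"
  shows "vf_bracket X Y \<in> g2"
proof -
  have neg: "- A - B \<in> g2" "- A + B \<in> g2" if "A \<in> g2" "B \<in> g2" for A B
    using that by (auto intro: span_diff span_add span_neg)
  show ?thesis
    using assms[unfolded set_X_list]
    by (elim insertE emptyE)
     (simp_all add: bracket_table span_add span_diff span_neg span_scale span_zero neg)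
qed

lemma vf_bracket_in_g2:
  assumes "X \<in> g2" "Y \<in> g2"
  shows "vf_bracket X Y \<in> g2"
proof -
  have z: "vf_bracket Z 0 = 0" "vf_bracket 0 Z = 0" if "smooth Z" for Z :: "real^5 \<Rightarrow> real^5"
    using vf_bracket_scaleR[of Z Z 0] that by simp_all
  have right: "vf_bracket X Y \<in> g2" if X: "X \<in> set X_list" and "Y \<in> g2" for X Y
  proof -
    \<comment> \<open>Smoothness is carried through the induction because additivity of the bracket
      requires it of the partial sum.\<close>
    from that(2) have "vf_bracket X Y \<in> g2 \<and> smooth Y"
    proof (induction rule: span_induct_alt)
      case base
      then show ?case using X by (simp add: z X_list_smooth span_zero del: zero_fun_apply)
    next
      case (step c Z W)
      then show ?case using X bracket_basis_in_g2[OF X step(1)]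
        by (simp add: vf_bracket_add vf_bracket_scaleR X_list_smooth span_add span_scale del: plus_fun_apply)
    qed
    then show ?thesis ..
  qed
  from assms(1) have "vf_bracket X Y \<in> g2 \<and> smooth X"
  proof (induction rule: span_induct_alt)
    case base
    then show ?case using assms(2) by (simp add: z g2_smooth span_zero del: zero_fun_apply)
  next
    case (step c Z W)
    then show ?case using right[OF step(1) assms(2)] assms(2)
      by (simp add: vf_bracket_add vf_bracket_scaleR X_list_smooth g2_smooth span_add span_scale del: plus_fun_apply)
  qed
  then show ?thesis ..
qed

lemma lie_algebra_g2: "lie_algebra g2 vf_bracket"
  by (intro lie_algebra_vector_fields subspace_span g2_smooth vf_bracket_in_g2)

lemma span_set_nth:
  fixes xs :: "'a::real_vector list"
  assumes "x \<in> span (set xs)"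
  obtains c where "x = (\<Sum>i<length xs. c i *\<^sub>R xs ! i)"
proof -
  from assms have "\<exists>c. x = (\<Sum>i<length xs. c i *\<^sub>R xs ! i)"
  proof (induction rule: span_induct_alt)
    case base
    show ?case by (intro exI[of _ "\<lambda>_. 0"]) simp
  next
    case (step a y z)
    then obtain c j where c: "z = (\<Sum>i<length xs. c i *\<^sub>R xs ! i)" and j: "j < length xs" "xs ! j = y"
      by (metis in_set_conv_nth)
    have "(\<Sum>i<length xs. (c i + (if i = j then a else 0)) *\<^sub>R xs ! i)
      = z + (\<Sum>i<length xs. if i = j then a *\<^sub>R y else 0)"
      unfolding c sum.distrib[symmetric] using j by (intro sum.cong) (auto simp: scaleR_left_distrib)
    also have "\<dots> = a *\<^sub>R y + z" using j by simp
    finally show ?case by metis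
  qed
  then show ?thesis using that by blast
qed

lemma g2_lincomb:
  assumes "X \<in> g2"
  obtains c where "X = (\<Sum>i<14. c i *\<^sub>R X_list ! i)"
  using span_set_nth[OF assms] unfolding length_X_list by blast

lemma lincomb_eq:
  assumes "(\<Sum>i<14. c i *\<^sub>R X_list ! i) = (\<Sum>i<14. d i *\<^sub>R X_list ! i)" "i < 14"
  shows "c i = d i"
  using X_list_lincomb_eq_0[of "\<lambda>i. c i - d i" i] assms
  by (simp add: scaleR_left_diff_distrib sum_subtractf)

section \<open>The root decomposition\<close>

abbreviation cartan :: "(real^5 \<Rightarrow> real^5) set" where "cartan \<equiv> span {X5, X8}"

text \<open>Eigenvalues of bracketing with \<open>X5\<close> on the fourteen fields. Positions count
  from 0, so position \<open>i\<close> belongs to the field numbered \<open>i + 1\<close>; in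
  particular 4 and 7 stand for \<open>X5\<close> and \<open>X8\<close>.\<close>

definition weight5 :: "real list" where
  "weight5 = [1, 0, 1, 2/3, 0, 1/3, -1/3, 0, 1/3, -1, -2/3, 0, -1/3, -1]"

definition weight8 :: "real list" where
  "weight8 = [1, 1, 0, 1/3, 0, 2/3, 1/3, 0, -1/3, 0, -1/3, -1, -2/3, -1]"

lemma less_14_cases: "i < 14 \<Longrightarrow> i \<in> {0, 1, 2, 3, 4, 5, 6, 7, 8, 9, 10, 11, 12, 13 :: nat}"
  by simp presburger

lemma bracket_weight:
  assumes "i < 14"
  shows "vf_bracket X5 (X_list ! i) = weight5 ! i *\<^sub>R X_list ! i"
    and "vf_bracket X8 (X_list ! i) = weight8 ! i *\<^sub>R X_list ! i"
  using less_14_cases[OF assms]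
  by (auto simp: X_list_def weight5_def weight8_def bracket_table)

lemma cartan_iff: "X \<in> cartan \<longleftrightarrow> (\<exists>s t. X = s *\<^sub>R X5 + t *\<^sub>R X8)"
proof
  assume "X \<in> cartan"
  then obtain s where "X - s *\<^sub>R X5 \<in> span {X8}" unfolding span_insert by blast
  then obtain t where "X - s *\<^sub>R X5 = t *\<^sub>R X8" unfolding span_singleton by blast
  then have "X = s *\<^sub>R X5 + t *\<^sub>R X8" by (simp add: algebra_simps)
  then show "\<exists>s t. X = s *\<^sub>R X5 + t *\<^sub>R X8" by blast
next
  show "\<exists>s t. X = s *\<^sub>R X5 + t *\<^sub>R X8 \<Longrightarrow> X \<in> cartan"
    by (elim exE) (simp add: span_add span_scale span_base)
qed

lemma cartan_subset_g2: "cartan \<subseteq> g2"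
  by (rule span_minimal) auto

lemma bracket_cartan:
  "vf_bracket (s *\<^sub>R X5 + t *\<^sub>R X8) (\<Sum>i<14. c i *\<^sub>R X_list ! i)
    = (\<Sum>i<14. (c i * (s * weight5 ! i + t * weight8 ! i)) *\<^sub>R X_list ! i)"
proof -
  have sm: "smooth (X_list ! i)" if "i < 14" for i
    using that X_list_smooth[of "X_list ! i"] by (simp add: length_X_list)
  have "vf_bracket (s *\<^sub>R X5 + t *\<^sub>R X8) (\<Sum>i<14. c i *\<^sub>R X_list ! i)
    = (\<Sum>i<14. vf_bracket (s *\<^sub>R X5 + t *\<^sub>R X8) (c i *\<^sub>R X_list ! i))"
    by (rule vf_bracket_sum_right) (simp_all add: sm)
  also have "\<dots> = (\<Sum>i<14. (c i * (s * weight5 ! i + t * weight8 ! i)) *\<^sub>R X_list ! i)"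
    by (rule sum.cong) (simp_all add: sm vf_bracket_add vf_bracket_scaleR bracket_weight algebra_simps)
  finally show ?thesis .
qed

lemma cartan_lincomb:
  "s *\<^sub>R X5 + t *\<^sub>R X8 = (\<Sum>i<14. (if i = 4 then s else if i = 7 then t else 0) *\<^sub>R X_list ! i)"
  by (simp add: sum_14 X_list_nth)

lemma bracket_cartan_cartan: "X \<in> cartan \<Longrightarrow> Y \<in> cartan \<Longrightarrow> vf_bracket X Y = 0"
  by (auto simp: cartan_iff vf_bracket_add vf_bracket_scaleR bracket_table)

text \<open>For \<open>s *\<^sub>R X5 + t *\<^sub>R X8\<close> the x-component at x = 1 is
  \<open>t\<close> and the z-component at z = 1 is \<open>s + t\<close>, so point evaluations
  recover both coefficients. The pair \<open>m\<close>, \<open>n\<close> gives the values on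
  \<open>X5\<close> and \<open>X8\<close>.\<close>

definition functional :: "real \<Rightarrow> real \<Rightarrow> (real^5 \<Rightarrow> real^5) \<Rightarrow> real" where
  "functional m n X = (if X \<in> cartan then
     m * (X (axis 3 1) $ 3 - X (axis 1 1) $ 1) + n * X (axis 1 1) $ 1 else 0)"

lemma functional_cartan [simp]: "functional m n (s *\<^sub>R X5 + t *\<^sub>R X8) = m * s + n * t"
proof -
  have "s *\<^sub>R X5 + t *\<^sub>R X8 \<in> cartan" by (auto simp: cartan_iff)
  then show ?thesis by (simp add: functional_def scaleR_fun_apply X_apply axis_def algebra_simps)
qed

lemma functional_dual: "functional m n \<in> dual_space cartan"
  by (auto simp: dual_space_def functional_def span_add span_scale scaleR_fun_apply algebra_simps)

lemma dual_eq_functional: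
  assumes "\<alpha> \<in> dual_space cartan"
  shows "\<alpha> = functional (\<alpha> X5) (\<alpha> X8)"
proof
  fix X
  show "\<alpha> X = functional (\<alpha> X5) (\<alpha> X8) X"
  proof (cases "X \<in> cartan")
    case True
    then obtain s t where X: "X = s *\<^sub>R X5 + t *\<^sub>R X8" unfolding cartan_iff by blast
    have "X5 \<in> cartan" "X8 \<in> cartan" by (auto intro: span_base)
    then show ?thesis
      using assms unfolding X functional_cartan by (simp add: dual_space_def span_scale)
  next
    case False
    then show ?thesis using assms by (simp add: dual_space_def functional_def)
  qed
qed

lemma functional_linear:
  "functional (m + m') (n + n') = functional m n + functional m' n'"
  "functional (c * m) (c * n) = c *\<^sub>R functional m n"
  "functional (- m) (- n) = - functional m n"
  by (auto simp: fun_eq_iff functional_def scaleR_fun_apply algebra_simps)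

lemma functional_eq_iff: "functional m n = functional m' n' \<longleftrightarrow> m = m' \<and> n = n'"
proof
  assume "functional m n = functional m' n'"
  then show "m = m' \<and> n = n'"
    using functional_cartan[of m n 1 0] functional_cartan[of m n 0 1]
      functional_cartan[of m' n' 1 0] functional_cartan[of m' n' 0 1] by simp
qed simp

lemma functional_eq_0_iff: "functional m n = 0 \<longleftrightarrow> m = 0 \<and> n = 0"
  using functional_eq_iff[of m n 0 0] functional_linear(2)[of 0 0 0] by simp

text \<open>The fields form an eigenbasis for the Cartan subalgebra, so coefficients can be compared
  one by one; testing with \<open>X5\<close> and \<open>X8\<close> alone recovers both
  weights.\<close>

lemma lincomb_weight_space:
  "(\<Sum>i<14. c i *\<^sub>R X_list ! i) \<in> weight_space g2 vf_bracket cartan (functional m n) \<longleftrightarrow>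
    (\<forall>i<14. c i = 0 \<or> weight5 ! i = m \<and> weight8 ! i = n)" (is "?X \<in> _ \<longleftrightarrow> ?R")
proof -
  have X: "?X \<in> g2" by (intro span_sum span_scale X_list_in_g2) (simp add: length_X_list)
  have "?X \<in> weight_space g2 vf_bracket cartan (functional m n) \<longleftrightarrow>
    (\<forall>s t. \<forall>i<14. c i * (s * weight5 ! i + t * weight8 ! i) = (m * s + n * t) * c i)"
  proof -
    have "vf_bracket (s *\<^sub>R X5 + t *\<^sub>R X8) ?X = functional m n (s *\<^sub>R X5 + t *\<^sub>R X8) *\<^sub>R ?X \<longleftrightarrow>
       (\<forall>i<14. c i * (s * weight5 ! i + t * weight8 ! i) = (m * s + n * t) * c i)" for s t
      unfolding bracket_cartan functional_cartan scaleR_sum_right scaleR_scaleR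
      by (auto dest: lincomb_eq intro!: sum.cong)
    moreover have "?X \<in> weight_space g2 vf_bracket cartan (functional m n) \<longleftrightarrow>
      (\<forall>s t. vf_bracket (s *\<^sub>R X5 + t *\<^sub>R X8) ?X = functional m n (s *\<^sub>R X5 + t *\<^sub>R X8) *\<^sub>R ?X)"
    proof -
      have "(\<forall>h\<in>cartan. P h) \<longleftrightarrow> (\<forall>s t. P (s *\<^sub>R X5 + t *\<^sub>R X8))" for P
        using cartan_iff by metis
      then show ?thesis unfolding weight_space_def using X by simp
    qed
    ultimately show ?thesis by simp
  qed
  also have "\<dots> \<longleftrightarrow> ?R"
  proof (intro iffI allI impI)
    fix i :: nat
    assume h: "\<forall>s t. \<forall>i<14. c i * (s * weight5 ! i + t * weight8 ! i) = (m * s + n * t) * c i" and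
      "i < 14"
    then have "c i * (s * weight5 ! i + t * weight8 ! i) = (m * s + n * t) * c i" for s t
      by blast
    from this[of 1 0] this[of 0 1] show "c i = 0 \<or> weight5 ! i = m \<and> weight8 ! i = n"
      by auto
  qed (auto simp: algebra_simps)
  finally show ?thesis .
qed

lemma X_list_weight_space:
  assumes "i < 14"
  shows "X_list ! i \<in> weight_space g2 vf_bracket cartan (functional (weight5 ! i) (weight8 ! i))"
proof -
  have "X_list ! i = (\<Sum>j<14. (if j = i then 1 else 0) *\<^sub>R X_list ! j)"
    using assms by (simp add: if_distrib[of "\<lambda>c. c *\<^sub>R _"] cong: if_cong)
  then show ?thesis
    using lincomb_weight_space[of "\<lambda>j. if j = i then 1 else 0"] assms by simp
qed

lemma nonzero_weight: "i < 14 \<Longrightarrow> weight5 ! i = 0 \<Longrightarrow> weight8 ! i = 0 \<Longrightarrow> i = 4 \<or> i = 7"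
  using less_14_cases[of i] by (auto simp: weight5_def weight8_def)

lemma lie_roots_g2:
  "lie_roots g2 vf_bracket cartan = {functional (weight5 ! i) (weight8 ! i) | i. i < 14 \<and> i \<noteq> 4
    \<and> i \<noteq> 7}"
  (is "?L = ?R")
proof
  show "?L \<subseteq> ?R"
  proof
    fix \<alpha> assume \<alpha>: "\<alpha> \<in> ?L"
    then obtain m n where mn: "\<alpha> = functional m n" using dual_eq_functional
      by (auto simp: lie_roots_def)
    \<comment> \<open>A set different from \<open>{0}\<close> has a nonzero element only if it is
      not empty, hence the check that 0 belongs to it.\<close>
    have "(\<Sum>i<14. 0 *\<^sub>R X_list ! i) \<in> weight_space g2 vf_bracket cartan \<alpha>"
      unfolding mn lincomb_weight_space by simp
    then have "0 \<in> weight_space g2 vf_bracket cartan \<alpha>" by simp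
    with \<alpha> obtain x where x: "x \<in> weight_space g2 vf_bracket cartan \<alpha>" "x \<noteq> 0"
      unfolding lie_roots_def by blast
    then obtain c where c: "x = (\<Sum>i<14. c i *\<^sub>R X_list ! i)" using g2_lincomb
      by (auto simp: weight_space_def)
    have "\<exists>i<14. c i \<noteq> 0" using x(2) unfolding c
      by (metis (no_types, lifting) lessThan_iff scaleR_zero_left sum.neutral)
    then obtain i where i: "i < 14" "weight5 ! i = m" "weight8 ! i = n"
      using x(1) unfolding c mn lincomb_weight_space by blast
    have "i \<noteq> 4 \<and> i \<noteq> 7"
      using \<alpha> i by (auto simp: mn lie_roots_def functional_eq_0_iff weight5_def weight8_def)
    with i show "\<alpha> \<in> ?R" unfolding mn by blast
  qed
  show "?R \<subseteq> ?L"
  proof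
    fix \<alpha> assume "\<alpha> \<in> ?R"
    then obtain i where i: "i < 14" "i \<noteq> 4" "i \<noteq> 7" "\<alpha> = functional (weight5 ! i) (weight8 ! i)"
      by blast
    have "X_list ! i \<noteq> 0"
      using X_list_lincomb_eq_0[of "\<lambda>j. if j = i then 1 else 0" i] i(1)
      by (auto simp: if_distrib[of "\<lambda>c. c *\<^sub>R _"] cong: if_cong)
    then show "\<alpha> \<in> ?L"
      using X_list_weight_space[OF i(1)] nonzero_weight[OF i(1)] i
      by (auto simp: lie_roots_def functional_dual functional_eq_0_iff)
  qed
qed

lemma splitting_cartan: "splitting_cartan_subalgebra g2 vf_bracket cartan"
  unfolding splitting_cartan_subalgebra_def cartan_subalgebra_def
proof (intro conjI)
  show "lie_algebra cartan vf_bracket"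
    using cartan_subset_g2 g2_smooth
    by (intro lie_algebra_vector_fields subspace_span) (auto simp: bracket_cartan_cartan span_zero)
  show "cartan \<subseteq> g2" by (rule cartan_subset_g2)
  have "{vf_bracket X Y | X Y. X \<in> cartan \<and> Y \<in> cartan} \<subseteq> {0}"
    by (auto simp: bracket_cartan_cartan)
  then have "lower_central vf_bracket cartan 1 \<subseteq> span {0}"
    unfolding One_nat_def lower_central.simps lie_product_def by (rule span_mono)
  then have "lower_central vf_bracket cartan 1 = {0}"
    unfolding One_nat_def lower_central.simps lie_product_def by (auto simp: span_zero)
  then show "\<exists>n. lower_central vf_bracket cartan n = {0}" ..
  show "lie_normalizer g2 vf_bracket cartan = cartan"
  proof
    show "cartan \<subseteq> lie_normalizer g2 vf_bracket cartan"
      using cartan_subset_g2 by (auto simp: lie_normalizer_def bracket_cartan_cartan span_zero)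
    show "lie_normalizer g2 vf_bracket cartan \<subseteq> cartan"
    proof
      fix X assume X: "X \<in> lie_normalizer g2 vf_bracket cartan"
      then obtain c where c: "X = (\<Sum>i<14. c i *\<^sub>R X_list ! i)" using g2_lincomb
        by (auto simp: lie_normalizer_def)
      \<comment> \<open>Bracketing with a Cartan element multiplies each coefficient by its weight.
        If the result stays in the Cartan subalgebra, all products outside positions 4 and 7 vanish,
        and there some weight is nonzero.\<close>
      have zero: "c i * (s * weight5 ! i + t * weight8 ! i) = 0" if i: "i < 14" "i \<noteq> 4" "i \<noteq> 7"
        for s t i
      proof -
        have "s *\<^sub>R X5 + t *\<^sub>R X8 \<in> cartan" by (auto simp: cartan_iff)
        then have "vf_bracket (s *\<^sub>R X5 + t *\<^sub>R X8) X \<in> cartan"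
          using X vf_bracket_antisym[of "s *\<^sub>R X5 + t *\<^sub>R X8" X]
            by (auto simp: lie_normalizer_def span_neg)
        then obtain s' t' where "vf_bracket (s *\<^sub>R X5 + t *\<^sub>R X8) X = s' *\<^sub>R X5 + t' *\<^sub>R X8"
          unfolding cartan_iff by blast
        then show ?thesis
          unfolding c bracket_cartan cartan_lincomb[of s' t'] using lincomb_eq i by fastforce
      qed
      have "c i = 0" if "i < 14" "i \<noteq> 4" "i \<noteq> 7" for i
        using zero[OF that, of 1 0] zero[OF that, of 0 1] nonzero_weight[of i] that by auto
      then have "X = (\<Sum>i<14. (if i = 4 then c 4 else if i = 7 then c 7 else 0) *\<^sub>R X_list ! i)"
        unfolding c by (intro sum.cong) auto
      then show "X \<in> cartan" unfolding cartan_lincomb[symmetric] cartan_iff by blast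
    qed
  qed
  let ?U = "\<Union>\<alpha>\<in>dual_space cartan. weight_space g2 vf_bracket cartan \<alpha>"
  show "span ?U = g2"
  proof
    show "span ?U \<subseteq> g2" by (rule span_minimal) (auto simp: weight_space_def)
    have "set X_list \<subseteq> ?U"
      using X_list_weight_space functional_dual by (force simp: in_set_conv_nth length_X_list)
    then show "g2 \<subseteq> span ?U" by (rule span_mono)
  qed
qed

lemma root_system_g2: "root_system_type_G2 g2 vf_bracket cartan"
proof -
  \<comment> \<open>The simple roots are the weights of \<open>X2\<close> (long) and
    \<open>X9\<close> (short); the opposite root vectors are \<open>X12\<close> and
    \<open>X7\<close>.\<close>
  define \<alpha> where "\<alpha> = functional 0 1"
  define \<beta> where "\<beta> = functional (1/3) (- 1/3)"
  have ne: "\<alpha> \<noteq> \<beta>" by (simp add: \<alpha>_def \<beta>_def functional_eq_iff)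
  have ws: "X2 \<in> weight_space g2 vf_bracket cartan \<alpha>" "X12 \<in> weight_space g2 vf_bracket cartan (- \<alpha>)"
    "X9 \<in> weight_space g2 vf_bracket cartan \<beta>" "X7 \<in> weight_space g2 vf_bracket cartan (- \<beta>)"
    using X_list_weight_space[of 1] X_list_weight_space[of 11] X_list_weight_space[of 8]
      X_list_weight_space[of 6]
    unfolding \<alpha>_def \<beta>_def functional_linear(3)[symmetric]
    by (simp_all add: weight5_def weight8_def X_list_def)
  have lin: "functional (real b / 3) (real a - real b / 3) = real a *\<^sub>R \<alpha> + real b *\<^sub>R \<beta>" for a b
    unfolding \<alpha>_def \<beta>_def functional_linear[symmetric] by simp
  have ind: "independent {\<alpha>, \<beta>}"
  proof -
    have "\<alpha> \<noteq> k *\<^sub>R \<beta>" for k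
      unfolding \<alpha>_def \<beta>_def functional_linear[symmetric] functional_eq_iff by auto
    moreover have "\<beta> \<noteq> 0" by (simp add: \<beta>_def functional_eq_0_iff)
    ultimately show ?thesis using ne by (auto simp: independent_insert span_singleton)
  qed
  have roots: "{\<alpha>, \<beta>} \<subseteq> lie_roots g2 vf_bracket cartan"
  proof -
    have "\<alpha> = functional (weight5 ! 1) (weight8 ! 1)" "\<beta> = functional (weight5 ! 8) (weight8 ! 8)"
      by (simp_all add: \<alpha>_def \<beta>_def weight5_def weight8_def)
    then show ?thesis unfolding lie_roots_g2 by force
  qed
  have comb: "\<exists>a b :: nat. \<gamma> = real a *\<^sub>R \<alpha> + real b *\<^sub>R \<beta> \<or> \<gamma> = - (real a *\<^sub>R \<alpha> + real b *\<^sub>R \<beta>)"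
    if "\<gamma> \<in> lie_roots g2 vf_bracket cartan" for \<gamma>
  proof -
    obtain i where i: "i < 14" "i \<noteq> 4" "i \<noteq> 7" "\<gamma> = functional (weight5 ! i) (weight8 ! i)"
      using \<open>\<gamma> \<in> _\<close> unfolding lie_roots_g2 by blast
    \<comment> \<open>Coefficients of \<alpha> and \<beta> in each root up to sign, by position. The
      highest root is 2 \<alpha> + 3 \<beta>, the weight of \<open>X1\<close>; zeros at positions 4
      and 7 are the Cartan directions.\<close>
    define A :: "nat list" where "A = [2, 1, 1, 1, 0, 1, 0, 0, 0, 1, 1, 1, 1, 2]"
    define B :: "nat list" where "B = [3, 0, 3, 2, 0, 1, 1, 0, 1, 3, 2, 0, 1, 3]"
    have "(weight5 ! i = real (B ! i) / 3 \<and> weight8 ! i = real (A ! i) - real (B ! i) / 3) \<or>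
      (weight5 ! i = - (real (B ! i) / 3) \<and> weight8 ! i = - (real (A ! i) - real (B ! i) / 3))"
      using less_14_cases[OF i(1)] by (auto simp: weight5_def weight8_def A_def B_def)
    then show ?thesis
      unfolding i(4) lin[symmetric] functional_linear(3)[symmetric] by metis
  qed
  have base: "root_base g2 vf_bracket cartan {\<alpha>, \<beta>}"
    unfolding root_base_def
  proof (intro conjI ballI ind roots)
    fix \<gamma> assume "\<gamma> \<in> lie_roots g2 vf_bracket cartan"
    then obtain a b :: nat where "\<gamma> = real a *\<^sub>R \<alpha> + real b *\<^sub>R \<beta> \<or> \<gamma> = - (real a *\<^sub>R \<alpha> + real b *\<^sub>R \<beta>)"
      using comb by blast
    then show "\<exists>c. \<gamma> = (\<Sum>\<delta>\<in>{\<alpha>, \<beta>}. real (c \<delta>) *\<^sub>R \<delta>) \<or> \<gamma> = - (\<Sum>\<delta>\<in>{\<alpha>, \<beta>}. real (c \<delta>) *\<^sub>R \<delta>)"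
      using ne by (intro exI[of _ "\<lambda>\<delta>. if \<delta> = \<alpha> then a else b"]) auto
  qed simp
  \<comment> \<open>The coroots are multiples of the brackets of opposite root vectors; the factors
    -1 and -3 below are forced by the value 2 of each root on its own coroot.\<close>
  define s where "s = (- 1) *\<^sub>R X5 + 2 *\<^sub>R X8"
  define t where "t = 3 *\<^sub>R X5 + (- 3) *\<^sub>R X8"
  have "(- 1) *\<^sub>R vf_bracket X2 X12 \<in> lie_product vf_bracket (weight_space g2 vf_bracket cartan \<alpha>) (weight_space g2 vf_bracket cartan (- \<alpha>))"
    unfolding lie_product_def using ws by (intro span_scale span_base) blast
  moreover have "(- 1) *\<^sub>R vf_bracket X2 X12 = s"
    by (simp add: bracket_table s_def)
  moreover have "\<alpha> s = 2" "\<beta> t = 2"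
    unfolding s_def t_def \<alpha>_def \<beta>_def functional_cartan by simp_all
  ultimately have coroot: "is_coroot g2 vf_bracket cartan \<alpha> s" "\<beta> t = 2"
    by (simp_all add: is_coroot_def)
  have "(- 3) *\<^sub>R vf_bracket X9 X7 \<in> lie_product vf_bracket (weight_space g2 vf_bracket cartan \<beta>) (weight_space g2 vf_bracket cartan (- \<beta>))"
    unfolding lie_product_def using ws by (intro span_scale span_base) blast
  moreover have "(- 3) *\<^sub>R vf_bracket X9 X7 = t"
    by (simp add: bracket_table t_def algebra_simps)
  ultimately have "is_coroot g2 vf_bracket cartan \<beta> t"
    using coroot(2) by (simp add: is_coroot_def)
  moreover have "\<beta> s = - 1" "\<alpha> t = - 3"
    unfolding s_def t_def \<alpha>_def \<beta>_def functional_cartan by simp_all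
  ultimately show ?thesis
    unfolding root_system_type_G2_def using ne base coroot(1) by blast
qed

section \<open>Simplicity\<close>

lemma vf_bracket_uminus:
  assumes "smooth X" "smooth Y"
  shows "vf_bracket X (- Y) = - vf_bracket X Y" "vf_bracket (- X) Y = - vf_bracket X Y"
  using vf_bracket_scaleR[OF assms, of "- 1"] by simp_all

lemma vf_bracket_diff:
  assumes "smooth X" "smooth Y" "smooth Z"
  shows "vf_bracket X (Y - Z) = vf_bracket X Y - vf_bracket X Z"
    and "vf_bracket (X - Y) Z = vf_bracket X Z - vf_bracket Y Z"
  using vf_bracket_add[of X Y "- Z"] vf_bracket_add[of X "- Y" Z] assms
    by (simp_all add: vf_bracket_uminus)

lemma vf_bracket_zero: "smooth X \<Longrightarrow> vf_bracket X 0 = 0"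
  using vf_bracket_scaleR(2)[of X X 0] by simp

text \<open>If \<open>X14\<close> is outside the ideal, any multiple of it found inside has
  coefficient zero. Applied degree by degree from the top, this kills all coefficients of
  \<open>x\<close> except that of \<open>X14\<close>.\<close>

lemma ideal_contains_X14:
  assumes I: "lie_ideal g2 vf_bracket I" and x: "x \<in> I" "x \<noteq> 0"
  shows "X14 \<in> I"
proof (rule ccontr)
  assume notin: "X14 \<notin> I"
  have sub: "subspace I" and ad: "\<And>y z. y \<in> g2 \<Longrightarrow> z \<in> I \<Longrightarrow> vf_bracket y z \<in> I"
    using I by (auto simp: lie_ideal_def)
  have key: "d = 0" if "d *\<^sub>R X14 \<in> I" for d
  proof (rule ccontr)
    assume "d \<noteq> 0"
    then show False using subspace_scale[OF sub that, of "inverse d"] notin by simp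
  qed
  obtain c where "x = (\<Sum>i<14. c i *\<^sub>R X_list ! i)"
    using I x(1) g2_lincomb by (auto simp: lie_ideal_def)
  then have xc: "x = c 0 *\<^sub>R X1 + c 1 *\<^sub>R X2 + c 2 *\<^sub>R X3 + c 3 *\<^sub>R X4 + c 4 *\<^sub>R X5 + c 5 *\<^sub>R X6
    + c 6 *\<^sub>R X7
     + c 7 *\<^sub>R X8 + c 8 *\<^sub>R X9 + c 9 *\<^sub>R X10 + c 10 *\<^sub>R X11 + c 11 *\<^sub>R X12 + c 12 *\<^sub>R X13 + c 13 *\<^sub>R X14"
    by (simp add: sum_14 X_list_nth)
  note calc = vf_bracket_add vf_bracket_scaleR vf_bracket_uminus vf_bracket_diff vf_bracket_zero bracket_table
    algebra_simps
  \<comment> \<open>Two brackets with \<open>X14\<close> lower the degree by 4, so only the degree 2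
    part of \<open>x\<close> survives, landing on \<open>X14\<close>.\<close>
  have "vf_bracket X14 (vf_bracket X14 x) = c 0 *\<^sub>R X14 + c 0 *\<^sub>R X14"
    unfolding xc by (simp add: calc)
  also have "\<dots> = (2 * c 0) *\<^sub>R X14"
    by (simp only: mult_2 scaleR_left_distrib)
  finally have c0: "c 0 = 0" using key[of "2 * c 0"] ad x(1) X_in_g2
    by (metis mult_eq_0_iff zero_neq_numeral)
  \<comment> \<open>A total drop of 3 isolates the degree 1 part, each of the four last brackets
    detecting one coefficient. Drops of 2 and 1 then treat degrees 0 and -1.\<close>
  have "vf_bracket X12 (vf_bracket X14 x) = c 1 *\<^sub>R X14"
    "vf_bracket X10 (vf_bracket X14 x) = (c 2 / 2) *\<^sub>R X14"
    "vf_bracket X11 (vf_bracket X14 x) = c 3 *\<^sub>R X14"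
    "vf_bracket X13 (vf_bracket X14 x) = (9 / 2 * c 5) *\<^sub>R X14"
    unfolding xc c0 by (simp_all add: calc)
  then have "c 1 *\<^sub>R X14 \<in> I" "(c 2 / 2) *\<^sub>R X14 \<in> I" "c 3 *\<^sub>R X14 \<in> I" "(9 / 2 * c 5) *\<^sub>R X14 \<in> I"
    using ad x(1) X_in_g2 by metis+
  then have c1: "c 1 = 0" "c 2 = 0" "c 3 = 0" "c 5 = 0"
    by (auto dest: key)
  have "vf_bracket X10 (vf_bracket X12 x) = (- c 7) *\<^sub>R X14"
    "vf_bracket X11 (vf_bracket X12 x) = c 6 *\<^sub>R X14"
    "vf_bracket X12 (vf_bracket X10 x) = c 4 *\<^sub>R X14"
    "vf_bracket X13 (vf_bracket X10 x) = (- c 8) *\<^sub>R X14"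
    unfolding xc c0 c1 by (simp_all add: calc)
  then have "(- c 7) *\<^sub>R X14 \<in> I" "c 6 *\<^sub>R X14 \<in> I" "c 4 *\<^sub>R X14 \<in> I" "(- c 8) *\<^sub>R X14 \<in> I"
    using ad x(1) X_in_g2 by metis+
  then have c2: "c 7 = 0" "c 6 = 0" "c 4 = 0" "c 8 = 0"
    by (metis key neg_equal_0_iff_equal)+
  have "vf_bracket X12 x = c 9 *\<^sub>R X14" "vf_bracket X13 x = c 10 *\<^sub>R X14"
    "vf_bracket X10 x = (- c 11) *\<^sub>R X14" "vf_bracket X11 x = (- c 12) *\<^sub>R X14"
    unfolding xc c0 c1 c2 by (simp_all add: calc)
  then have "c 9 *\<^sub>R X14 \<in> I" "c 10 *\<^sub>R X14 \<in> I" "(- c 11) *\<^sub>R X14 \<in> I" "(- c 12) *\<^sub>R X14 \<in> I"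
    using ad x(1) X_in_g2 by metis+
  then have c3: "c 9 = 0" "c 10 = 0" "c 11 = 0" "c 12 = 0"
    by (metis key neg_equal_0_iff_equal)+
  have "x = c 13 *\<^sub>R X14" unfolding xc c0 c1 c2 c3 by simp
  with x key show False by force
qed

text \<open>Once \<open>X5\<close> and \<open>X8\<close> are in the ideal, every other basis field
  is too, as an eigenvector of one of them with nonzero eigenvalue.\<close>

lemma ideal_eq_g2:
  assumes I: "lie_ideal g2 vf_bracket I" and "X14 \<in> I"
  shows "I = g2"
proof
  show "I \<subseteq> g2" using I by (simp add: lie_ideal_def)
  have sub: "subspace I" and ad: "\<And>y z. y \<in> g2 \<Longrightarrow> z \<in> I \<Longrightarrow> vf_bracket y z \<in> I"
    using I by (auto simp: lie_ideal_def)
  have sc: "y \<in> I" if "a *\<^sub>R y \<in> I" "a \<noteq> 0" for a y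
    using subspace_scale[OF sub that(1), of "inverse a"] that(2) by simp
  have "vf_bracket X3 X14 \<in> I" "vf_bracket X1 X14 \<in> I" using assms(2) by (simp_all add: ad)
  then have X12: "X12 \<in> I" and "- X5 - X8 \<in> I"
    by (auto simp: bracket_table intro: sc)
  have "vf_bracket X2 X12 \<in> I" using X12 by (simp add: ad)
  \<comment> \<open>The bracket of \<open>X2\<close> and \<open>X12\<close> is \<open>X5\<close>
    minus twice \<open>X8\<close>, independent of the grading element, so the two together yield
    \<open>X5\<close> and \<open>X8\<close> separately.\<close>
  have "(- X5 - X8) + vf_bracket X2 X12 = (- 3) *\<^sub>R X8"
    "(- 2) *\<^sub>R (- X5 - X8) + vf_bracket X2 X12 = 3 *\<^sub>R X5"
    using scaleR_left_distrib[of 1 2 X8] scaleR_left_distrib[of 1 2 X5]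
    by (simp_all add: bracket_table algebra_simps)
  then have H: "X5 \<in> I" "X8 \<in> I"
    using sub \<open>- X5 - X8 \<in> I\<close> \<open>vf_bracket X2 X12 \<in> I\<close>
    by (metis sc subspace_add subspace_scale neg_equal_0_iff_equal zero_neq_numeral)+
  have "X_list ! i \<in> I" if i: "i < 14" for i
  proof (cases "i = 4 \<or> i = 7")
    case True
    then show ?thesis using H by (auto simp: X_list_nth)
  next
    case False
    then have "weight5 ! i \<noteq> 0 \<or> weight8 ! i \<noteq> 0" using nonzero_weight i by blast
    moreover have "X_list ! i \<in> g2" using i by (intro X_list_in_g2) (simp add: length_X_list)
    then have "- vf_bracket (X_list ! i) X5 \<in> I" "- vf_bracket (X_list ! i) X8 \<in> I"
      using H ad sub by (auto intro: subspace_neg)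
    then have "weight5 ! i *\<^sub>R X_list ! i \<in> I" "weight8 ! i *\<^sub>R X_list ! i \<in> I"
      unfolding vf_bracket_antisym[symmetric] bracket_weight[OF i] .
    ultimately show ?thesis using sc by blast
  qed
  then have "set X_list \<subseteq> I" by (auto simp: in_set_conv_nth length_X_list)
  then show "g2 \<subseteq> I" using sub by (rule span_minimal)
qed

lemma simple_g2: "simple_lie_algebra g2 vf_bracket"
  unfolding simple_lie_algebra_def
proof (intro conjI allI impI lie_algebra_g2)
  have "X14 \<noteq> 0" by (auto simp: fun_eq_iff X_apply vec_eq_iff forall_5)
  then have "vf_bracket X5 X14 \<noteq> 0" by (simp add: bracket_table)
  then show "\<exists>x\<in>g2. \<exists>y\<in>g2. vf_bracket x y \<noteq> 0" using X_in_g2 by blast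
next
  fix I assume I: "lie_ideal g2 vf_bracket I"
  then have "0 \<in> I" by (simp add: lie_ideal_def subspace_0)
  then show "I = {0} \<or> I = g2"
    using ideal_contains_X14[OF I] ideal_eq_g2[OF I] by blast
qed

theorem proposition4p4:
  shows "split_real_form_g2 (infinitesimal_symmetries omega0 Upsilon) vf_bracket \<and>
    infinitesimal_symmetries omega0 Upsilon =
      span {X1, X2, X3, X4, X5, X6, X7, X8, X9, X10, X11, X12, X13, X14}"
proof
  show "infinitesimal_symmetries omega0 Upsilon =
      span {X1, X2, X3, X4, X5, X6, X7, X8, X9, X10, X11, X12, X13, X14}"
    by (simp only: symmetries_eq_span set_X_list)
  show "split_real_form_g2 (infinitesimal_symmetries omega0 Upsilon) vf_bracket"
    unfolding split_real_form_g2_def symmetries_eq_span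
    using simple_g2 splitting_cartan root_system_g2 by blast
qed

end
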